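(* For any $\eta>0$, any integer $q\ge 3$ and any $m\in\mathbb{N}$ such that $$q \le 0.005\,\eta\left(\frac{\log m}{\log\log m}\right)^{1/4},$$ we have $$g_q(m)\ \ge\ m^{\frac{1-\eta}{q^2-q-\eta}}.$$
   Context: Logarithms are natural. For a finite set $P$ of points in the plane $\mathbb{R}^2$, $H_q(P)$ denotes the (non-uniform) hypergraph whose vertex set is $P$ and whose hyperedges are all sets $S\subset P$ with $|S|\ge q$ such that $S=P\cap \ell$ for some line $\ell$. A proper coloring of a hypergraph with $c$ colors is a map from its vertex set to $\{1,\dots,c\}$ such that no hyperedge is monochromatic; the chromatic number $\chi(H)$ is the minimum number of colors sufficient for a proper coloring of $H$. Define $g_q(m)=\max_{|P|=m}\chi(H_q(P))$, the maximum being over all sets $P$ of $m$ points in the plane.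
   Formalization: The formal statement additionally assumes η < q² − q; at η = q² − q the exponent is undefined, and for η > q² − q it exceeds 1, so the claim fails because g_q(m) ≤ m (e.g. q = 3, η = 10, m huge). *)

theory Defs
  imports "HOL-Analysis.Analysis"
begin

text \<open>A hypergraph is given by its vertex set and its set of hyperedges.\<close>

type_synonym 'a hypergraph = "'a set \<times> 'a set set"

definition monochromatic :: "('a \<Rightarrow> nat) \<Rightarrow> 'a set \<Rightarrow> bool" where
  "monochromatic f S \<longleftrightarrow> (\<exists>k. \<forall>x\<in>S. f x = k)"

definition proper_coloring :: "'a hypergraph \<Rightarrow> nat \<Rightarrow> ('a \<Rightarrow> nat) \<Rightarrow> bool" where
  "proper_coloring H c f \<longleftrightarrow>
     f ` fst H \<subseteq> {1..c} \<and> (\<forall>S\<in>snd H. \<not> monochromatic f S)"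

text \<open>
  This is meaningful only if some proper coloring exists, which can fail for hyperedges with at
  most one element; see \<open>ex_proper_coloring_line_hypergraph\<close> below.
\<close>

definition chromatic_number :: "'a hypergraph \<Rightarrow> nat" where
  "chromatic_number H = (LEAST c. \<exists>f. proper_coloring H c f)"

definition is_line :: "(real ^ 2) set \<Rightarrow> bool" where
  "is_line l \<longleftrightarrow> affine l \<and> aff_dim l = 1"

definition line_hypergraph :: "nat \<Rightarrow> (real ^ 2) set \<Rightarrow> (real ^ 2) hypergraph" where
  "line_hypergraph q P =
     (P, {S. S \<subseteq> P \<and> q \<le> card S \<and> (\<exists>l. is_line l \<and> S = P \<inter> l)})"

text \<open>
  The maximum is over a finite nonempty set for every \<open>q \<ge> 2\<close>; see
  \<open>finite_line_chromatic_numbers\<close> and \<open>line_chromatic_numbers_nonempty\<close> below.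
\<close>

definition g_lines :: "nat \<Rightarrow> nat \<Rightarrow> nat" where
  "g_lines q m = Max {chromatic_number (line_hypergraph q P) | P. finite P \<and> card P = m}"

lemma ex_proper_coloring_line_hypergraph:
  assumes "2 \<le> q" and "finite P"
  shows "\<exists>f. proper_coloring (line_hypergraph q P) (card P) f"
proof -
  obtain f where f: "bij_betw f P {1..card P}"
    using \<open>finite P\<close> by (metis finite_same_card_bij finite_atLeastAtMost card_atLeastAtMost diff_Suc_1)
  have "\<not> monochromatic f S" if S: "S \<subseteq> P" "q \<le> card S" for S
  proof
    assume "monochromatic f S"
    then obtain k where "f ` S \<subseteq> {k}"
      by (auto simp: monochromatic_def)
    then have "card (f ` S) \<le> 1"
      using card_mono[of "{k}" "f ` S"] by simp
    moreover have "card (f ` S) = card S"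
      using f S by (meson bij_betw_def card_image inj_on_subset)
    ultimately show False
      using S assms by linarith
  qed
  then show ?thesis
    using f by (auto simp: proper_coloring_def line_hypergraph_def bij_betw_def)
qed

lemma finite_line_chromatic_numbers:
  assumes "2 \<le> q"
  shows "finite {chromatic_number (line_hypergraph q P) | P. finite P \<and> card P = m}"
proof (rule finite_subset)
  have "chromatic_number (line_hypergraph q P) \<le> card P" if "finite P" for P
    unfolding chromatic_number_def
    by (rule Least_le) (rule ex_proper_coloring_line_hypergraph[OF assms that])
  then show "{chromatic_number (line_hypergraph q P) | P. finite P \<and> card P = m} \<subseteq> {..m}"
    by auto
qed simp

lemma line_chromatic_numbers_nonempty:
  "{chromatic_number (line_hypergraph q P) | P. finite P \<and> card P = m} \<noteq> {}"
proof -
  have "infinite (UNIV :: (real ^ 2) set)"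
    using uncountable_ball[of 1 "0 :: real ^ 2"] by (meson countable_finite finite_subset subset_UNIV zero_less_one)
  then obtain P :: "(real ^ 2) set" where "finite P" "card P = m"
    by (meson infinite_arbitrarily_large)
  then show ?thesis
    by blast
qed

end

theory Submission
  imports Defs
begin

text \<open>
  The point sets are random subsets of a planar grid. Let \<open>V\<close> consist of \<open>k\<close> columns of integer points
  of height \<open>k * B\<close>, with \<open>B = M ^ (q - 1)\<close>, and consider only the lines \<open>x = a + b * t\<close> with integer
  slope \<open>0 \<le> b < B\<close>. Every point lies on exactly \<open>B\<close> of them, each meets at most \<open>k\<close> points, and
  \<open>k\<close> is only a constant (depending on \<open>q\<close>) times the number \<open>c\<close> of colors. This is just enough for a
  set with more than a fraction \<open>1 / (16 * c)\<close> of the grid to contain many points of many lines.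
  
  Call \<open>I \<subseteq> V\<close> independent if every chosen line meets it in fewer than \<open>q\<close> points. The heart of the
  proof is a container theorem (\<open>containers\<close>, in the locale \<open>line_system\<close>): all independent sets are covered by
  few sets, each with at most a fraction \<open>1 / (16 * c)\<close> of the points of \<open>V\<close>. A proper coloring of a
  point set \<open>P \<subseteq> V\<close> with \<open>c\<close> colors splits it into independent sets, provided that no chosen line has more
  than \<open>q\<close> points in \<open>P\<close>, for then a line with \<open>q\<close> points of one color is a monochromatic hyperedge.
  So \<open>P\<close> would lie in a union of \<open>c\<close> containers, a set with at most one sixteenth of all points. There
  are few such unions, and a random \<open>m\<close>-tuple of grid points, minus one point for each \<open>q + 1\<close>
  indices whose points lie on a chosen line, avoids all of them (\<open>sparse_sample\<close>).
  
  With \<open>B\<close>, \<open>k\<close> as above the deletion costs at most half of the points if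
  \<open>4 * B * (m * k) ^ q \<le> card V ^ q\<close>, while the number of containers demands that \<open>m\<close> exceed
  \<open>c\<^sup>2 * M ^ (q - 2)\<close> by a factor \<open>E\<close> that depends on \<open>q\<close> and \<open>log m\<close> only. Both hold for a suitable \<open>M\<close>
  once \<open>m\<close> is at least \<open>c ^ ((q - 1)\<^sup>2 + 1)\<close> times a power of \<open>E\<close> with exponent about \<open>q\<^sup>2\<close>
  (\<open>colors_less_g_lines\<close>). The exponent
  \<open>(q - 1)\<^sup>2 + 1\<close> is smaller than \<open>q\<^sup>2 - q\<close>, so a number of colors below
  \<open>m powr (1 / (q\<^sup>2 - q))\<close> leaves a spare factor of at least \<open>m powr (1 / (2 * q))\<close>, and the hypothesis on
  \<open>q\<close> makes the lower-order terms fit into it (\<open>parameters_fit\<close>).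
\<close>

section \<open>Containers for systems of lines\<close>

text \<open>
  A container family arises from a decision tree of depth \<open>s\<close> with at most \<open>n\<close> children per node. The sets
  \<open>\<S>\<close> are the admissible containers and \<open>\<I>\<close> are the sets that are still possible at the node.
\<close>
definition covered :: "nat \<Rightarrow> 'a set set \<Rightarrow> nat \<Rightarrow> 'a set set \<Rightarrow> bool" where
  "covered n \<S> s \<I> \<longleftrightarrow>
     (\<exists>\<C>\<subseteq>\<S>. finite \<C> \<and> card \<C> \<le> n ^ s \<and> (\<forall>I\<in>\<I>. \<exists>C\<in>\<C>. I \<subseteq> C))"

lemma covered_mono:
  assumes "covered n \<S> s \<I>" "\<J> \<subseteq> \<I>" "s \<le> t" "1 \<le> n"
  shows "covered n \<S> t \<J>"
proof -
  have "n ^ s \<le> n ^ t" using assms by (simp add: power_increasing)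
  then show ?thesis using assms unfolding covered_def by (meson le_trans subsetD)
qed

text \<open>
  One decision asks for an element of \<open>Q\<close> that the unknown set contains, or learns that there is none.
\<close>
lemma covered_branch:
  assumes Q: "finite Q" "card Q < n"
    and none: "covered n \<S> s {I \<in> \<I>. I \<inter> Q = {}}"
    and some: "\<And>z. z \<in> Q \<Longrightarrow> covered n \<S> s {I \<in> \<I>. z \<in> I}"
  shows "covered n \<S> (Suc s) \<I>"
proof -
  define \<J> where "\<J> x = (case x of None \<Rightarrow> {I \<in> \<I>. I \<inter> Q = {}} | Some z \<Rightarrow> {I \<in> \<I>. z \<in> I})" for x
  define X where "X = insert None (Some ` Q)"
  have X: "finite X" "card X \<le> n"
    using Q by (auto simp: X_def card_image card_insert_if)
  have "\<forall>x\<in>X. covered n \<S> s (\<J> x)"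
    using none some by (auto simp: X_def \<J>_def)
  then obtain \<C> where \<C>: "\<And>x. x \<in> X \<Longrightarrow> \<C> x \<subseteq> \<S> \<and> finite (\<C> x) \<and> card (\<C> x) \<le> n ^ s \<and> (\<forall>I\<in>\<J> x. \<exists>C\<in>\<C> x. I \<subseteq> C)"
    unfolding covered_def by metis
  have "card (\<Union>x\<in>X. \<C> x) \<le> (\<Sum>x\<in>X. card (\<C> x))"
    by (rule card_UN_le[OF X(1)])
  also have "\<dots> \<le> card X * n ^ s"
    using \<C> by (metis sum_bounded_above of_nat_id)
  also have "\<dots> \<le> n ^ Suc s"
    using X(2) by simp
  finally have card: "card (\<Union>x\<in>X. \<C> x) \<le> n ^ Suc s" .
  have cov: "\<exists>C\<in>(\<Union>x\<in>X. \<C> x). I \<subseteq> C" if I: "I \<in> \<I>" for I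
  proof (cases "I \<inter> Q = {}")
    case True
    then have x: "None \<in> X" "I \<in> \<J> None"
      using I by (auto simp: X_def \<J>_def)
    then obtain C where "C \<in> \<C> None" "I \<subseteq> C"
      using \<C>[OF x(1)] by blast
    then show ?thesis using x by blast
  next
    case False
    then obtain z where "z \<in> Q" "z \<in> I"
      by blast
    then have x: "Some z \<in> X" "I \<in> \<J> (Some z)"
      using I by (auto simp: X_def \<J>_def)
    then obtain C where "C \<in> \<C> (Some z)" "I \<subseteq> C"
      using \<C>[OF x(1)] by blast
    then show ?thesis using x by blast
  qed
  show ?thesis
    unfolding covered_def
  proof (intro exI conjI)
    show "(\<Union>x\<in>X. \<C> x) \<subseteq> \<S>" "finite (\<Union>x\<in>X. \<C> x)"
      using \<C> X(1) by (simp_all add: UN_least)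
    show "card (\<Union>x\<in>X. \<C> x) \<le> n ^ Suc s" "\<forall>I\<in>\<I>. \<exists>C\<in>(\<Union>x\<in>X. \<C> x). I \<subseteq> C"
      using card cov by simp_all
  qed
qed

text \<open>
  \<open>M\<close> is the factor by which the degree demanded in one phase of the container argument drops to the
  next; \<open>q\<close> is the size of a forbidden collinear set.
\<close>
locale line_system =
  fixes V :: "'a set" and \<L> :: "'a set set" and q M :: nat and \<S> :: "'a set set"
  assumes finite_points: "finite V" and finite_lines: "finite \<L>"
    and linear: "\<And>l l' x y. l \<in> \<L> \<Longrightarrow> l' \<in> \<L> \<Longrightarrow> x \<noteq> y \<Longrightarrow>
           x \<in> l \<Longrightarrow> x \<in> l' \<Longrightarrow> y \<in> l \<Longrightarrow> y \<in> l' \<Longrightarrow> l = l'"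
    and M_ge: "4 \<le> M"
begin

definition deg :: "'a set set \<Rightarrow> 'a \<Rightarrow> nat" where
  "deg X z = card {l \<in> X. z \<in> l}"

text \<open>
  The candidates at a node of the decision tree: \<open>F\<close> has been learnt, \<open>U\<close> is the current container.
\<close>
definition independents :: "'a set \<Rightarrow> 'a set \<Rightarrow> 'a set set" where
  "independents F U = {I. F \<subseteq> I \<and> I \<subseteq> U \<and> (\<forall>l\<in>\<L>. card (l \<inter> I) < q)}"

abbreviation cov :: "nat \<Rightarrow> 'a set set \<Rightarrow> bool" where
  "cov \<equiv> covered (Suc (card V)) \<S>"

lemma deg_mono: "X \<subseteq> Y \<Longrightarrow> Y \<subseteq> \<L> \<Longrightarrow> deg X z \<le> deg Y z"
  unfolding deg_def using finite_lines by (intro card_mono) (auto intro: finite_subset)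

lemma sum_deg:
  assumes "finite R" "X \<subseteq> \<L>"
  shows "(\<Sum>z\<in>R. deg X z) = (\<Sum>l\<in>X. card (l \<inter> R))"
proof -
  have fin: "finite X" using assms finite_lines finite_subset by blast
  have "(\<Sum>z\<in>R. deg X z) = (\<Sum>z\<in>R. \<Sum>l\<in>X. if z \<in> l then 1 else 0)"
    unfolding deg_def using fin by (simp add: sum.If_cases Int_def)
  also have "\<dots> = (\<Sum>l\<in>X. \<Sum>z\<in>R. if z \<in> l then 1 else 0)"
    by (rule sum.swap)
  also have "\<dots> = (\<Sum>l\<in>X. card (l \<inter> R))"
    using assms by (simp add: sum.If_cases Int_def conj_commute)
  finally show ?thesis .
qed

text \<open>
  Every point of \<open>R\<close> is on at least \<open>K\<close> lines of \<open>X\<close>, and on fewer than \<open>K / 4\<close> lines that are already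
  used. The lines that are poor in points of \<open>R\<close> carry few incidences, so for half of \<open>R\<close> a quarter
  of the lines are both unused and rich.
\<close>
lemma many_progressive:
  fixes b :: real
  assumes "finite R" "X' \<subseteq> X" "X \<subseteq> \<L>"
    and K: "\<And>z. z \<in> R \<Longrightarrow> K \<le> deg X z" "\<And>z. z \<in> R \<Longrightarrow> deg X' z < K'" "4 * K' \<le> K" "0 < K"
    and b: "4 * b * card X \<le> real K * card R" "0 < b"
  shows "card R \<le> 2 * card {z \<in> R. K \<le> 4 * deg {l \<in> X - X'. b \<le> card (l \<inter> R)} z}"
proof -
  define G where "G = {l \<in> X - X'. b \<le> card (l \<inter> R)}"
  define light where "light = {l \<in> X. card (l \<inter> R) < b}"
  define Q where "Q = {z \<in> R. K \<le> 4 * deg G z}"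
  have fin: "finite X" "finite X'"
    using assms(2,3) finite_lines by (auto dest: finite_subset)
  have split: "deg X z \<le> deg X' z + deg G z + deg light z" for z
  proof -
    have "{l \<in> X. z \<in> l} \<subseteq> {l \<in> X'. z \<in> l} \<union> {l \<in> G. z \<in> l} \<union> {l \<in> light. z \<in> l}"
      by (auto simp: G_def light_def)
    then have "deg X z \<le> card ({l \<in> X'. z \<in> l} \<union> {l \<in> G. z \<in> l} \<union> {l \<in> light. z \<in> l})"
      unfolding deg_def using fin by (intro card_mono) (auto simp: G_def light_def)
    also have "\<dots> \<le> deg X' z + deg G z + deg light z"
      unfolding deg_def by (intro order_trans[OF card_Un_le] add_mono card_Un_le order_refl)
    finally show ?thesis .
  qed
  have "K \<le> 2 * deg light z" if z: "z \<in> R - Q" for z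
    using split[of z] K(1,2)[of z] K(3) z unfolding Q_def by auto
  then have "card (R - Q) * K \<le> (\<Sum>z\<in>R - Q. 2 * deg light z)"
    using sum_bounded_below[of "R - Q" K "\<lambda>z. 2 * deg light z"] by simp
  also have "\<dots> \<le> (\<Sum>z\<in>R. 2 * deg light z)"
    using assms(1) by (intro sum_mono2) auto
  also have "\<dots> = 2 * (\<Sum>l\<in>light. card (l \<inter> R))"
    using assms by (subst sum_distrib_left[symmetric], subst sum_deg) (auto simp: light_def)
  finally have "real (card (R - Q) * K) \<le> real (2 * (\<Sum>l\<in>light. card (l \<inter> R)))"
    by (rule of_nat_mono)
  also have "\<dots> = 2 * (\<Sum>l\<in>light. real (card (l \<inter> R)))"
    by simp
  also have "\<dots> \<le> 2 * (card light * b)"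
    using sum_bounded_above[of light "\<lambda>l. real (card (l \<inter> R))" b] by (simp add: light_def)
  also have "\<dots> \<le> 2 * (card X * b)"
    using fin b(2) by (auto simp: light_def intro!: mult_right_mono card_mono)
  finally have "4 * (real K * card (R - Q)) \<le> 4 * (2 * (card X * b))"
    by (simp add: mult.commute)
  also have "\<dots> \<le> 2 * (real K * card R)"
    using b(1) by (simp add: algebra_simps)
  finally have "real K * (2 * card (R - Q)) \<le> real K * card R"
    by simp
  then have "2 * card (R - Q) \<le> card R"
    using \<open>0 < K\<close> by (simp add: mult_le_cancel_left)
  moreover have "card (R - Q) = card R - card Q" "card Q \<le> card R"
    using assms(1) by (auto simp: Q_def card_Diff_subset card_mono)
  ultimately show ?thesis
    unfolding Q_def G_def by simp
qed


text \<open>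
  The progress towards the next phase: a point of \<open>A\<close> is saturated once \<open>K\<close> lines of \<open>X\<close> pass through
  it, and further lines through it do not count.
\<close>
definition potential :: "'a set \<Rightarrow> nat \<Rightarrow> 'a set set \<Rightarrow> nat" where
  "potential A K X = (\<Sum>y\<in>A. min (deg X y) K)"

lemma potential_le: "potential A K X \<le> card A * K"
  unfolding potential_def using sum_bounded_above[of A "\<lambda>y. min (deg X y) K" K] by simp

text \<open>
  By linearity the new lines through \<open>z\<close> meet nowhere else, so each of their further points in \<open>R\<close> gains
  exactly one line; as these points are not saturated, the gain is counted in full.
\<close>
lemma potential_increase:
  fixes b :: real
  assumes A: "finite A" "R \<subseteq> A" and z: "z \<in> R"
    and low: "\<And>y. y \<in> R \<Longrightarrow> deg X y < K"
    and X: "X \<subseteq> \<L>"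
    and G: "G \<subseteq> \<L>" "G \<inter> X = {}" "\<And>l. l \<in> G \<Longrightarrow> z \<in> l \<and> b \<le> card (l \<inter> R)"
  shows "potential A K X + card G * (b - 1) \<le> potential A K (X \<union> G)"
proof -
  define T where "T = (\<Union>l\<in>G. l \<inter> (R - {z}))"
  have fin: "finite G" "finite X" "finite R"
    using G(1) X A finite_lines by (auto dest: finite_subset)
  have T: "finite T" "T \<subseteq> R"
    using fin by (auto simp: T_def)
  have "card G * (b - 1) \<le> (\<Sum>l\<in>G. real (card (l \<inter> (R - {z}))))"
  proof -
    have "b - 1 \<le> real (card (l \<inter> (R - {z})))" if "l \<in> G" for l
    proof -
      have "l \<inter> R = insert z (l \<inter> (R - {z}))"
        using G(3)[OF that] z by auto
      then have "card (l \<inter> R) = Suc (card (l \<inter> (R - {z})))"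
        using fin by (metis Diff_iff IntD2 card_insert_disjoint finite_Diff finite_Int insertCI)
      then show ?thesis using G(3)[OF that] by simp
    qed
    then show ?thesis
      using sum_bounded_below[of G "b - 1" "\<lambda>l. real (card (l \<inter> (R - {z})))"] by simp
  qed
  also have "\<dots> = real (card T)"
  proof -
    have "card T = (\<Sum>l\<in>G. card (l \<inter> (R - {z})))"
      unfolding T_def
    proof (rule card_UN_disjoint)
      show "\<forall>l\<in>G. \<forall>l'\<in>G. l \<noteq> l' \<longrightarrow> l \<inter> (R - {z}) \<inter> (l' \<inter> (R - {z})) = {}"
      proof (intro ballI impI)
        fix l l' assume l: "l \<in> G" "l' \<in> G" "l \<noteq> l'"
        have "False" if y: "y \<in> l" "y \<in> l'" "y \<noteq> z" for y
          using linear[of l l' y z] l y G(1) G(3)[OF l(1)] G(3)[OF l(2)] by blast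
        then show "l \<inter> (R - {z}) \<inter> (l' \<inter> (R - {z})) = {}" by blast
      qed
    qed (use fin in auto)
    then show ?thesis by simp
  qed
  finally have cardT: "card G * (b - 1) \<le> card T" .
  have "min (deg X y) K + (if y \<in> T then 1 else 0) \<le> min (deg (X \<union> G) y) K" for y
  proof (cases "y \<in> T")
    case True
    then obtain l where l: "l \<in> G" "y \<in> l"
      by (auto simp: T_def)
    have "{l \<in> X. y \<in> l} \<subset> {l \<in> X \<union> G. y \<in> l}"
      using l G(2) by blast
    then have "deg X y < deg (X \<union> G) y"
      unfolding deg_def using fin by (intro psubset_card_mono) auto
    moreover have "deg X y < K"
      using True low T(2) by blast
    ultimately show ?thesis
      using True by (simp add: min_def)
  next
    case False
    then show ?thesis
      using deg_mono[of X "X \<union> G" y] X G(1) by auto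
  qed
  then have "(\<Sum>y\<in>A. min (deg X y) K + (if y \<in> T then 1 else 0)) \<le> potential A K (X \<union> G)"
    unfolding potential_def by (rule sum_mono)
  moreover have "(\<Sum>y\<in>A. min (deg X y) K + (if y \<in> T then 1 else 0)) = potential A K X + card T"
  proof -
    have "A \<inter> {y. y \<in> T} = T"
      using A(2) T(2) by auto
    then show ?thesis
      using A(1) by (simp add: potential_def sum.distrib sum.If_cases)
  qed
  ultimately have "potential A K X + card T \<le> potential A K (X \<union> G)"
    by simp
  then show ?thesis using cardT by linarith
qed

text \<open>
  One phase of the container argument. The lines of \<open>X\<close> already have \<open>j\<close> points in the known part \<open>F\<close> of the
  unknown independent set \<open>I\<close>, and each point of \<open>A\<close> lies on \<open>K\<close> of them. Let \<open>R\<close> be the points of \<open>A\<close>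
  that are not saturated. By \<open>many_progressive\<close> half of them, the set \<open>Q\<close>, are on many unused rich lines. If
  \<open>I\<close> avoids \<open>Q\<close>, a positive fraction of \<open>A\<close> is discarded (\<open>shrink\<close>). Otherwise a point of \<open>I \<inter> Q\<close> is
  learnt, the unused rich lines through it gain a point of \<open>F\<close>, and the potential grows by at least
  \<open>K * (b - 1) / 4\<close>. As the potential is at most \<open>card A * K'\<close>, after at most \<open>t\<close> such steps most of
  \<open>A\<close> is saturated and the next phase starts (\<open>continue\<close>). The potential also bounds the number of lines
  handed over; that bound is what lets the richness \<open>b\<close> drop by only a constant factor per phase.
\<close>
lemma phase:
  fixes b b' :: real
  assumes sets: "F \<subseteq> V" "A \<subseteq> V" "A \<inter> F = {}" "X \<subseteq> \<L>"
    and touch: "\<And>l. l \<in> X \<Longrightarrow> j \<le> card (l \<inter> F)"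
    and K: "\<And>z. z \<in> A \<Longrightarrow> K \<le> deg X z" "4 * K' \<le> K" "0 < K'"
    and b: "5 \<le> b" "32 * b' \<le> b - 1" "16 * b * card X \<le> real K * card A"
    and steps: "4 * real (card A) * K' \<le> t * (real K * (b - 1))"
    and shrink: "\<And>Q. Q \<subseteq> A \<Longrightarrow> card A \<le> 8 * card Q \<Longrightarrow> cov s (independents F (U - Q))"
    and continue: "\<And>F' X' A'. F' \<subseteq> V \<Longrightarrow> A' \<subseteq> A \<Longrightarrow> A' \<inter> F' = {} \<Longrightarrow> X' \<subseteq> X \<Longrightarrow>
        (\<And>l. l \<in> X' \<Longrightarrow> Suc j \<le> card (l \<inter> F')) \<Longrightarrow> (\<And>z. z \<in> A' \<Longrightarrow> K' \<le> deg X' z) \<Longrightarrow>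
        card A \<le> 2 * card A' \<Longrightarrow> 16 * b' * card X' \<le> real K' * card A' \<Longrightarrow>
        cov s (independents F' U)"
  shows "cov (s + t) (independents F U)"
proof -
  let ?\<Phi> = "potential A K'"
  have finA: "finite A"
    using sets finite_points by (auto dest: finite_subset)
  \<comment> \<open>The three inequalities bound the points learnt, the lines used, and the steps left by the potential.\<close>
  have main: "cov (s + t) (independents F' U)"
    if "F \<subseteq> F'" "F' \<subseteq> V" "X' \<subseteq> X" "\<And>l. l \<in> X' \<Longrightarrow> Suc j \<le> card (l \<inter> F')"
      and "real (card (F' - F)) * (K * (b - 1)) \<le> 4 * ?\<Phi> X'" "card X' * (b - 1) \<le> ?\<Phi> X'"
      and "4 * (real (card A) * K') \<le> 4 * ?\<Phi> X' + t * (K * (b - 1))"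
    for F' X' t
    using that
  proof (induction t arbitrary: F' X' rule: less_induct)
    case (less t)
    note F' = less.prems(1,2) and X' = less.prems(3) and touch' = less.prems(4)
      and few = less.prems(5,6) and left = less.prems(7)
    define R where "R = {y \<in> A - F'. deg X' y < K'}"
    have R: "finite R" "R \<subseteq> A"
      using finA by (auto simp: R_def)
    have fin: "finite F'" "finite X" "finite X'"
      using F' X' sets(4) finite_points finite_lines by (auto dest: finite_subset)
    have pot: "real (?\<Phi> X') \<le> real (card A) * K'"
      using potential_le[of A K' X'] by (metis of_nat_le_iff of_nat_mult)
    have Kb: "0 < K * (b - 1)" "16 * real K' \<le> K * (b - 1)"
    proof -
      show "0 < K * (b - 1)" using K(2,3) b(1) by (intro mult_pos_pos) linarith+
      have "real (4 * K') * 4 \<le> K * (b - 1)"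
        using K(2) b(1) by (intro mult_mono) simp_all
      then show "16 * real K' \<le> K * (b - 1)" by simp
    qed
    show ?case
    proof (cases "4 * card R \<le> card A")
      case True
      define A' where "A' = A - F' - R"
      have "real (card (F' - F)) * (16 * real K') \<le> real (card (F' - F)) * (K * (b - 1))"
        using Kb(2) by (intro mult_left_mono) simp_all
      also have "\<dots> \<le> 4 * (real (card A) * K')"
        using few(1) pot by linarith
      finally have F_few: "4 * card (F' - F) \<le> card A"
        using K(3) by (simp add: mult.assoc[symmetric] del: of_nat_mult)
      have "A \<subseteq> A' \<union> R \<union> (F' - F)"
        using sets(3) by (auto simp: A'_def)
      then have "card A \<le> card (A' \<union> R \<union> (F' - F))"
        using finA R(1) fin(1) by (intro card_mono) (auto simp: A'_def)
      also have "\<dots> \<le> card A' + card R + card (F' - F)"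
        by (intro order_trans[OF card_Un_le] add_mono card_Un_le order_refl)
      finally have A': "card A \<le> 2 * card A'"
        using True F_few by linarith
      have "16 * b' * card X' \<le> (b - 1) * card X' / 2"
        using mult_right_mono[OF b(2), of "real (card X')"] by (simp add: algebra_simps)
      also have "\<dots> \<le> real (card A) * K' / 2"
        using few(2) pot by (simp add: mult.commute)
      also have "\<dots> \<le> real (2 * card A') * K' / 2"
        using A' by (intro divide_right_mono mult_right_mono) linarith+
      finally have "16 * b' * card X' \<le> real K' * card A'"
        by (simp add: mult.commute)
      then have "cov s (independents F' U)"
        using A' F' X' touch' by (intro continue[of F' A' X']) (auto simp: A'_def R_def)
      then show ?thesis
        by (rule covered_mono) simp_all
    next
      case False
      define G where "G = {l \<in> X - X'. b \<le> card (l \<inter> R)}"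
      define Q where "Q = {z \<in> R. K \<le> 4 * deg G z}"
      have "R \<noteq> {}"
        using False by auto
      then have "(\<Sum>y\<in>R. min (deg X' y) K') < (\<Sum>y\<in>R. K')"
        using R(1) by (intro sum_strict_mono) (auto simp: R_def)
      then have "?\<Phi> X' < (\<Sum>y\<in>A. K')"
        unfolding potential_def sum.subset_diff[OF R(2) finA]
        by (intro add_le_less_mono sum_mono) simp_all
      then have "real (?\<Phi> X') < real (card A) * K'"
        by (metis of_nat_less_iff of_nat_mult sum_constant of_nat_id)
      \<comment> \<open>An unsaturated point is left, so the potential is not exhausted and there is a step to spend.\<close>
      then have "t \<noteq> 0"
        using left by (intro notI) simp
      then obtain t' where t: "t = Suc t'"
        using not0_implies_Suc by blast
      have "4 * (4 * b * card X) \<le> real K * card A"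
        using b(3) by simp
      also have "\<dots> \<le> real K * (4 * card R)"
        using False by (intro mult_left_mono) linarith+
      finally have "4 * b * card X \<le> real K * card R"
        by simp
      then have "card R \<le> 2 * card Q"
        unfolding Q_def G_def using K R X' sets(4) b(1)
        by (intro many_progressive[where K' = K']) (auto simp: R_def)
      then have Q: "card A \<le> 8 * card Q" "Q \<subseteq> A" "finite Q"
        using False R by (auto simp: Q_def)
      have "cov (Suc (s + t')) (independents F' U)"
      proof (rule covered_branch[of Q])
        show "card Q < Suc (card V)"
          using Q sets(2) finite_points by (meson card_mono le_imp_less_Suc order_trans)
        show "cov (s + t') {I \<in> independents F' U. I \<inter> Q = {}}"
          by (rule covered_mono[OF shrink[OF Q(2,1)]]) (use less.prems(1) in \<open>auto simp: independents_def\<close>)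
      next
        fix z assume z: "z \<in> Q"
        define H where "H = {l \<in> G. z \<in> l}"
        have zR: "z \<in> R" "K \<le> 4 * card H"
          using z unfolding Q_def H_def deg_def by simp_all
        have finH: "finite H"
          using fin(2) by (auto simp: H_def G_def)
        have pot': "?\<Phi> X' + card H * (b - 1) \<le> ?\<Phi> (X' \<union> H)"
          by (rule potential_increase[OF finA R(2) zR(1)])
            (use X' sets(4) in \<open>auto simp: R_def H_def G_def\<close>)
        have H: "K * (b - 1) \<le> 4 * (card H * (b - 1))"
          using mult_right_mono[of "real K" "4 * real (card H)" "b - 1"] zR(2) b(1) by simp
        have "cov (s + t') (independents (insert z F') U)"
        proof (rule less.IH)
          show "t' < t" using t by simp
          show "F \<subseteq> insert z F'" "insert z F' \<subseteq> V" "X' \<union> H \<subseteq> X"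
            using F' X' zR(1) R(2) sets(2) by (auto simp: H_def G_def)
          show "Suc j \<le> card (l \<inter> insert z F')" if "l \<in> X' \<union> H" for l
          proof (cases "l \<in> X'")
            case True
            have "card (l \<inter> F') \<le> card (l \<inter> insert z F')"
              using fin by (intro card_mono) auto
            then show ?thesis using touch'[OF True] by linarith
          next
            case False
            then have l: "l \<in> X" "z \<in> l"
              using that by (auto simp: H_def G_def)
            have "z \<notin> F"
              using zR(1) R(2) sets(3) by blast
            then have "Suc (card (l \<inter> F)) = card (insert z (l \<inter> F))"
              using fin(1) F'(1) finite_subset by (subst card_insert_disjoint) auto
            also have "\<dots> \<le> card (l \<inter> insert z F')"
              using fin(1) F'(1) l(2) by (intro card_mono) auto
            finally show ?thesis using touch[OF l(1)] by linarith
          qed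
          have "insert z F' - F \<subseteq> insert z (F' - F)"
            by blast
          then have "card (insert z F' - F) \<le> card (insert z (F' - F))"
            using fin(1) by (intro card_mono) auto
          also have "\<dots> \<le> Suc (card (F' - F))"
            by (simp add: card_insert_le_m1 card_insert_if fin(1))
          finally have "real (card (insert z F' - F)) * (K * (b - 1)) \<le> (1 + real (card (F' - F))) * (K * (b - 1))"
            using Kb(1) by (intro mult_right_mono) linarith+
          also have "\<dots> \<le> 4 * ?\<Phi> (X' \<union> H)"
            using few(1) pot' H by (simp add: distrib_right)
          finally show "real (card (insert z F' - F)) * (K * (b - 1)) \<le> 4 * ?\<Phi> (X' \<union> H)" .
          have "card (X' \<union> H) * (b - 1) \<le> (real (card X') + card H) * (b - 1)"
            using card_Un_le[of X' H] b(1) by (intro mult_right_mono) linarith+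
          then show "card (X' \<union> H) * (b - 1) \<le> ?\<Phi> (X' \<union> H)"
            using few(2) pot' by (simp add: distrib_right)
          show "4 * (real (card A) * K') \<le> 4 * ?\<Phi> (X' \<union> H) + t' * (K * (b - 1))"
            using left pot' H by (simp add: t distrib_right)
        qed
        then show "cov (s + t') {I \<in> independents F' U. z \<in> I}"
          by (rule covered_mono) (auto simp: independents_def)
      qed (fact Q)
      then show ?thesis by (simp add: t)
    qed
  qed
  show ?thesis
    by (rule main[of F "{}" t]) (use sets steps in \<open>auto simp: mult_ac\<close>)
qed


text \<open>
  After \<open>q - 1\<close> phases every point of \<open>A\<close> lies on a line with \<open>q - 1\<close> known points of the independent set,
  so none of them can belong to it. Hence \<open>U\<close> loses a fraction \<open>1 / 2 ^ (q + 1)\<close> of its points, whichever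
  way the phases end. The richness \<open>\<beta> * 33 ^ i\<close> decreases by 33 because a phase needs
  \<open>32 * b' \<le> b - 1\<close>.
\<close>
lemma phases:
  fixes \<beta> :: real
  assumes U: "U \<subseteq> V" "card U \<le> 4 * t * M * \<beta>"
    and \<beta>: "1 \<le> \<beta>"
    and shrink: "\<And>Q. Q \<subseteq> U \<Longrightarrow> card U \<le> 2 ^ (q + 1) * card Q \<Longrightarrow> cov s (independents {} (U - Q))"
    and q: "q = Suc (i + j)"
    and sets: "F \<subseteq> V" "A \<subseteq> U" "A \<inter> F = {}" "X \<subseteq> \<L>"
    and touch: "\<And>l. l \<in> X \<Longrightarrow> j \<le> card (l \<inter> F)"
    and degs: "\<And>z. z \<in> A \<Longrightarrow> M ^ i \<le> deg X z"
    and X: "16 * (\<beta> * 33 ^ i) * card X \<le> real (M ^ i) * card A"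
    and A: "card U \<le> 2 ^ j * card A"
  shows "cov (s + i * t) (independents F U)"
  using q sets touch degs X A
proof (induction i arbitrary: j F A X)
  case 0
  have "I \<subseteq> U - A" if I: "I \<in> independents F U" for I
  proof -
    have "z \<notin> I" if z: "z \<in> A" for z
    proof
      assume "z \<in> I"
      have "{l \<in> X. z \<in> l} \<noteq> {}"
        using 0(7)[OF z] by (auto simp: deg_def simp del: Collect_empty_eq)
      then obtain l where l: "l \<in> X" "z \<in> l"
        by blast
      have "z \<notin> F" "finite F"
        using 0(2,4) z finite_points finite_subset by auto
      moreover have "finite I"
        using I U(1) finite_points by (auto simp: independents_def dest: finite_subset)
      ultimately have "Suc (card (l \<inter> F)) \<le> card (l \<inter> I)"
        using I l(2) \<open>z \<in> I\<close> card_mono[of "l \<inter> I" "insert z (l \<inter> F)"]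
        by (auto simp: independents_def)
      moreover have "card (l \<inter> I) < q"
        using I l(1) 0(5) by (auto simp: independents_def)
      ultimately show False
        using 0(1) 0(6)[OF l(1)] by simp
    qed
    then show ?thesis using I by (auto simp: independents_def)
  qed
  then have sub: "independents F U \<subseteq> independents {} (U - A)"
    by (auto simp: independents_def)
  have "card U \<le> 2 ^ (q + 1) * card A"
    using 0(9) by (rule order_trans) (use 0(1) in \<open>auto intro!: mult_right_mono power_increasing\<close>)
  from shrink[OF 0(3) this] show ?case
    using sub by (rule covered_mono) simp_all
next
  case (Suc i)
  have b: "33 * \<beta> \<le> \<beta> * 33 ^ Suc i"
    using \<beta> by simp
  have "cov (s + i * t + t) (independents F U)"
  proof (rule phase[where j = j and X = X and A = A and K = "M ^ Suc i" and K' = "M ^ i"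
        and b = "\<beta> * 33 ^ Suc i" and b' = "\<beta> * 33 ^ i"])
    show "F \<subseteq> V" "A \<subseteq> V" "A \<inter> F = {}" "X \<subseteq> \<L>"
      using Suc.prems(2-5) U(1) by auto
    show "j \<le> card (l \<inter> F)" if "l \<in> X" for l
      using Suc.prems(6) that .
    show "M ^ Suc i \<le> deg X z" if "z \<in> A" for z
      using Suc.prems(7) that .
    show "4 * M ^ i \<le> M ^ Suc i" "0 < M ^ i"
      using M_ge by auto
    show "5 \<le> \<beta> * 33 ^ Suc i"
      using b \<beta> by linarith
    have "1 * 1 \<le> \<beta> * 33 ^ i"
      using \<beta> by (intro mult_mono) simp_all
    then show "32 * (\<beta> * 33 ^ i) \<le> \<beta> * 33 ^ Suc i - 1"
      by simp
    show "16 * (\<beta> * 33 ^ Suc i) * real (card X) \<le> real (M ^ Suc i) * real (card A)"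
      by (rule Suc.prems(8))
    have "card A \<le> card U"
      using Suc.prems(3) U(1) finite_points by (meson card_mono finite_subset)
    then have "4 * real (card A) \<le> t * (M * (16 * \<beta>))"
      using U(2) by (simp add: mult_ac)
    also have "\<dots> \<le> t * (M * (\<beta> * 33 ^ Suc i - 1))"
      using b \<beta> by (intro mult_left_mono) linarith+
    finally have "4 * real (card A) * real (M ^ i) \<le> t * (M * (\<beta> * 33 ^ Suc i - 1)) * real (M ^ i)"
      by (rule mult_right_mono) simp
    then show "4 * real (card A) * real (M ^ i) \<le> t * (real (M ^ Suc i) * (\<beta> * 33 ^ Suc i - 1))"
      by (simp add: mult_ac)
  next
    fix Q assume Q: "Q \<subseteq> A" "card A \<le> 8 * card Q"
    have "card U \<le> 2 ^ j * (8 * card Q)"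
      using Suc.prems(9) Q(2) by (meson le_trans mult_le_mono2)
    also have "\<dots> = 2 ^ (j + 3) * card Q"
      by (simp add: power_add)
    also have "\<dots> \<le> 2 ^ (q + 1) * card Q"
      using Suc.prems(1) by (intro mult_right_mono power_increasing) auto
    finally show "cov (s + i * t) (independents F (U - Q))"
      using Q(1) Suc.prems(3)
      by (intro covered_mono[OF shrink[of Q]]) (auto simp: independents_def)
  next
    fix F' X' A'
    assume *: "F' \<subseteq> V" "A' \<subseteq> A" "A' \<inter> F' = {}" "X' \<subseteq> X"
      "\<And>l. l \<in> X' \<Longrightarrow> Suc j \<le> card (l \<inter> F')" "\<And>z. z \<in> A' \<Longrightarrow> M ^ i \<le> deg X' z"
      "card A \<le> 2 * card A'" "16 * (\<beta> * 33 ^ i) * real (card X') \<le> real (M ^ i) * real (card A')"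
    have "card U \<le> 2 ^ j * (2 * card A')"
      using Suc.prems(9) *(7) by (meson le_trans mult_le_mono2)
    then have "card U \<le> 2 ^ Suc j * card A'"
      by simp
    then show "cov (s + i * t) (independents F' U)"
      using * Suc.prems(1-5) by (intro Suc.IH[of "Suc j" F' A' X']) auto
  qed
  then show ?case by (simp add: add_ac)
qed

text \<open>
  The initial richness \<open>\<beta> * 33 ^ (q - 1)\<close> is one sixteenth of \<open>M ^ (q - 1) * card U / card \<L>\<close>, a lower
  bound for the average number of points of \<open>U\<close> on a line. It is proportional to \<open>card U\<close>, so the bound \<open>t\<close> on the steps of a phase does not depend on
  \<open>U\<close>. Without this, early epochs, with large \<open>U\<close>, would be too expensive by a factor of about \<open>c\<close>.
\<close>
lemma epoch:
  assumes q: "1 \<le> q" and U: "U \<subseteq> V" "U \<noteq> {}"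
    and degs: "\<And>z. z \<in> V \<Longrightarrow> M ^ (q - 1) \<le> deg \<L> z"
    and big: "16 * 33 ^ (q - 1) * card \<L> \<le> M ^ (q - 1) * card U"
    and t: "4 * 33 ^ (q - 1) * card \<L> \<le> t * M ^ q"
    and shrink: "\<And>Q. Q \<subseteq> U \<Longrightarrow> card U \<le> 2 ^ (q + 1) * card Q \<Longrightarrow> cov s (independents {} (U - Q))"
  shows "cov (s + (q - 1) * t) (independents {} U)"
proof -
  define D where "D = real (16 * 33 ^ (q - 1) * card \<L>)"
  define \<beta> where "\<beta> = real (M ^ (q - 1) * card U) / D"
  have finU: "finite U" "0 < card U"
    using U finite_points by (auto simp: card_gt_0_iff dest: finite_subset)
  obtain z where z: "z \<in> U" using U(2) by blast
  have "0 < M ^ (q - 1)"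
    using M_ge by simp
  also have "\<dots> \<le> deg \<L> z"
    using degs z U(1) by blast
  also have "\<dots> \<le> card \<L>"
    unfolding deg_def using finite_lines by (intro card_mono) auto
  finally have D: "0 < D"
    by (simp add: D_def)
  show ?thesis
  proof (rule phases[where \<beta> = \<beta> and j = 0 and A = U and X = \<L>])
    have "D \<le> real (M ^ (q - 1) * card U)"
      unfolding D_def using big by (rule of_nat_mono)
    then show "1 \<le> \<beta>"
      using D by (simp add: \<beta>_def)
    have "D * card U \<le> real (t * M ^ q) * 4 * card U"
      using of_nat_mono[OF t, where ?'a = real] unfolding D_def by (intro mult_right_mono) (auto simp: mult_ac)
    also have "M ^ q = M * M ^ (q - 1)"
      using q by (simp add: power_eq_if)
    finally show "real (card U) \<le> real (4 * t * M) * \<beta>"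
      using D by (simp add: \<beta>_def field_simps)
    show "16 * (\<beta> * 33 ^ (q - 1)) * real (card \<L>) \<le> real (M ^ (q - 1)) * real (card U)"
    proof -
      have "16 * (\<beta> * 33 ^ (q - 1)) * real (card \<L>) = \<beta> * D"
        by (simp add: D_def)
      also have "\<dots> = real (M ^ (q - 1)) * real (card U)"
        using D by (simp add: \<beta>_def)
      finally show ?thesis by simp
    qed
  qed (use U degs shrink q in auto)
qed

text \<open>
  Epochs are repeated until at most \<open>w\<close> points are left.
\<close>
lemma containers:
  fixes w :: real
  assumes q: "1 \<le> q" and w: "0 \<le> w"
    and degs: "\<And>z. z \<in> V \<Longrightarrow> M ^ (q - 1) \<le> deg \<L> z"
    and big: "16 * 33 ^ (q - 1) * real (card \<L>) \<le> M ^ (q - 1) * w"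
    and t: "4 * 33 ^ (q - 1) * card \<L> \<le> t * M ^ q"
    and \<S>: "\<S> = {C. C \<subseteq> V \<and> real (card C) \<le> w}"
    and U: "U \<subseteq> V" "(1 - 1 / 2 ^ (q + 1)) ^ r * real (card U) \<le> w"
  shows "cov (r * ((q - 1) * t)) (independents {} U)"
  using U
proof (induction r arbitrary: U)
  case 0
  then show ?case
    unfolding covered_def by (intro exI[of _ "{U}"]) (auto simp: \<S> independents_def)
next
  case (Suc r)
  show ?case
  proof (cases "card U \<le> w")
    case True
    then show ?thesis
      unfolding covered_def using Suc.prems(1)
      by (intro exI[of _ "{U}"]) (auto simp: \<S> independents_def)
  next
    case False
    have finU: "finite U"
      using Suc.prems(1) finite_points by (auto dest: finite_subset)
    have "cov (r * ((q - 1) * t) + (q - 1) * t) (independents {} U)"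
    proof (rule epoch[OF q Suc.prems(1) _ degs _ t])
      show "U \<noteq> {}"
        using False w by auto
      have "16 * 33 ^ (q - 1) * real (card \<L>) \<le> M ^ (q - 1) * real (card U)"
        using big False mult_left_mono[of w "card U" "real (M ^ (q - 1))"] by linarith
      then have "real (16 * 33 ^ (q - 1) * card \<L>) \<le> real (M ^ (q - 1) * card U)"
        by simp
      then show "16 * 33 ^ (q - 1) * card \<L> \<le> M ^ (q - 1) * card U"
        by (simp only: of_nat_le_iff)
    next
      fix Q assume Q: "Q \<subseteq> U" "card U \<le> 2 ^ (q + 1) * card Q"
      have "real (card U) \<le> 2 ^ (q + 1) * real (card Q)"
        using of_nat_mono[OF Q(2), where ?'a = real] by simp
      then have "real (card (U - Q)) \<le> (1 - 1 / 2 ^ (q + 1)) * real (card U)"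
        using Q(1) finU by (simp add: card_Diff_subset finite_subset card_mono of_nat_diff field_simps)
      then have "(1 - 1 / 2 ^ (q + 1)) ^ r * real (card (U - Q)) \<le> (1 - 1 / 2 ^ (q + 1)) ^ Suc r * real (card U)"
        unfolding power_Suc2 mult.assoc by (rule mult_left_mono) (simp add: divide_le_eq_1 one_le_power mult_ge1_I)
      then show "cov (r * ((q - 1) * t)) (independents {} (U - Q))"
        using Suc.prems by (intro Suc.IH) auto
    qed
    then show ?thesis by (simp add: add.commute)
  qed
qed

end

section \<open>Sparse random samples that avoid given sets\<close>

text \<open>
  Choose the image of the first index, then a line through it, then the other \<open>q\<close> images on that line.
  The division by \<open>card V ^ q\<close> is cleared so that natural numbers suffice.
\<close>
lemma card_functions_meeting_line:
  assumes V: "finite V" and \<L>: "finite \<L>"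
    and k: "\<And>l. l \<in> \<L> \<Longrightarrow> card (l \<inter> V) \<le> k"
    and D: "\<And>z. z \<in> V \<Longrightarrow> card {l \<in> \<L>. z \<in> l} \<le> D"
    and T: "T \<subseteq> {..<m}" "card T = Suc q"
  shows "card {f \<in> {..<m} \<rightarrow>\<^sub>E V. \<exists>l\<in>\<L>. f ` T \<subseteq> l} * card V ^ q \<le> D * k ^ q * card V ^ m"
proof -
  have finT: "finite T" "T \<noteq> {}"
    using T finite_subset by auto
  define t where "t = Min T"
  have t: "t \<in> T" "t < m"
    using finT T(1) by (auto simp: t_def dest: Min_in)
  define \<F> where "\<F> z l = Pi\<^sub>E {..<m} (\<lambda>i. if i = t then {z} else if i \<in> T then l \<inter> V else V)" for z l
  have finF: "finite (\<F> z l)" for z l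
    unfolding \<F>_def using V by (intro finite_PiE) auto
  have cardF: "card (\<F> z l) \<le> k ^ q * card V ^ (m - Suc q)" if "l \<in> \<L>" for z l
  proof -
    define c where "c i = card (if i = t then {z} else if i \<in> T then l \<inter> V else V)" for i
    have "card (\<F> z l) = (\<Prod>i<m. c i)"
      unfolding \<F>_def c_def by (rule card_PiE) simp
    also have "\<dots> = (\<Prod>i\<in>{..<m} - T. c i) * (\<Prod>i\<in>T. c i)"
      by (rule prod.subset_diff[OF T(1)]) simp
    also have "(\<Prod>i\<in>{..<m} - T. c i) = (\<Prod>i\<in>{..<m} - T. card V)"
      using t by (intro prod.cong) (auto simp: c_def)
    also have "\<dots> = card V ^ (m - Suc q)"
      using T finT by (simp add: card_Diff_subset)
    also have "(\<Prod>i\<in>T. c i) = (\<Prod>i\<in>T - {t}. c i)"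
      using prod.remove[OF finT(1) t(1), of c] by (simp add: c_def)
    also have "\<dots> \<le> (\<Prod>i\<in>T - {t}. k)"
      using k[OF that] by (intro prod_mono) (auto simp: c_def)
    also have "\<dots> = k ^ q"
      using T finT t by simp
    finally show ?thesis by (simp add: mult.commute)
  qed
  have "{f \<in> {..<m} \<rightarrow>\<^sub>E V. \<exists>l\<in>\<L>. f ` T \<subseteq> l} \<subseteq> (\<Union>z\<in>V. \<Union>l\<in>{l \<in> \<L>. z \<in> l}. \<F> z l)"
  proof
    fix f assume "f \<in> {f \<in> {..<m} \<rightarrow>\<^sub>E V. \<exists>l\<in>\<L>. f ` T \<subseteq> l}"
    then obtain l where f: "f \<in> {..<m} \<rightarrow>\<^sub>E V" and l: "l \<in> \<L>" "f ` T \<subseteq> l"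
      by blast
    have "f t \<in> V" "f t \<in> l" "f \<in> \<F> (f t) l"
      using f l t by (auto simp: \<F>_def PiE_iff)
    then show "f \<in> (\<Union>z\<in>V. \<Union>l\<in>{l \<in> \<L>. z \<in> l}. \<F> z l)"
      using l(1) by blast
  qed
  then have "card {f \<in> {..<m} \<rightarrow>\<^sub>E V. \<exists>l\<in>\<L>. f ` T \<subseteq> l} \<le> card (\<Union>z\<in>V. \<Union>l\<in>{l \<in> \<L>. z \<in> l}. \<F> z l)"
    using V \<L> finF by (intro card_mono) auto
  also have "\<dots> \<le> (\<Sum>z\<in>V. card (\<Union>l\<in>{l \<in> \<L>. z \<in> l}. \<F> z l))"
    using V by (rule card_UN_le)
  also have "\<dots> \<le> (\<Sum>z\<in>V. D * (k ^ q * card V ^ (m - Suc q)))"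
  proof (rule sum_mono)
    fix z assume z: "z \<in> V"
    have "card (\<Union>l\<in>{l \<in> \<L>. z \<in> l}. \<F> z l) \<le> (\<Sum>l\<in>{l \<in> \<L>. z \<in> l}. card (\<F> z l))"
      using \<L> by (intro card_UN_le) simp
    also have "\<dots> \<le> of_nat (card {l \<in> \<L>. z \<in> l}) * (k ^ q * card V ^ (m - Suc q))"
      using cardF by (intro sum_bounded_above) auto
    also have "\<dots> \<le> D * (k ^ q * card V ^ (m - Suc q))"
      using D[OF z] by (intro mult_right_mono) simp_all
    finally show "card (\<Union>l\<in>{l \<in> \<L>. z \<in> l}. \<F> z l) \<le> D * (k ^ q * card V ^ (m - Suc q))" .
  qed
  also have "\<dots> = D * k ^ q * (card V * card V ^ (m - Suc q))"
    by simp
  finally have "card {f \<in> {..<m} \<rightarrow>\<^sub>E V. \<exists>l\<in>\<L>. f ` T \<subseteq> l} * card V ^ q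
      \<le> D * k ^ q * (card V * card V ^ (m - Suc q)) * card V ^ q"
    by (rule mult_right_mono) simp
  also have "\<dots> = D * k ^ q * card V ^ (Suc (m - Suc q) + q)"
    by (simp add: power_add mult_ac)
  also have "Suc (m - Suc q) + q = m"
    using T card_mono[OF _ T(1)] by simp
  finally show ?thesis .
qed

lemma card_functions_mostly_in:
  assumes V: "finite V" and W: "W \<subseteq> V" "16 * card W \<le> card V"
  shows "card {f \<in> {..<m} \<rightarrow>\<^sub>E V. m \<le> 2 * card {i. i < m \<and> f i \<in> W}} * 2 ^ m \<le> card V ^ m"
proof -
  define \<F> where "\<F> J = Pi\<^sub>E {..<m} (\<lambda>i. if i \<in> J then W else V)" for J :: "nat set"
  define \<J> where "\<J> = {J. J \<subseteq> {..<m} \<and> m \<le> 2 * card J}"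
  have finJ: "finite \<J>"
    by (rule finite_subset[of _ "Pow {..<m}"]) (auto simp: \<J>_def)
  have cardF: "card (\<F> J) * 4 ^ m \<le> card V ^ m" if "J \<in> \<J>" for J
  proof -
    have J: "J \<subseteq> {..<m}" "finite J" "m \<le> 2 * card J"
      using that finite_subset by (auto simp: \<J>_def)
    define c where "c i = card (if i \<in> J then W else V)" for i
    have "card (\<F> J) = (\<Prod>i<m. c i)"
      unfolding \<F>_def c_def by (rule card_PiE) simp
    also have "\<dots> = (\<Prod>i\<in>{..<m} - J. c i) * (\<Prod>i\<in>J. c i)"
      by (rule prod.subset_diff[OF J(1)]) simp
    also have "\<dots> = card V ^ (m - card J) * card W ^ card J"
      using J by (simp add: c_def card_Diff_subset)
    finally have "card (\<F> J) * 4 ^ m = card V ^ (m - card J) * card W ^ card J * 4 ^ m"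
      by simp
    also have "\<dots> \<le> card V ^ (m - card J) * card W ^ card J * 4 ^ (2 * card J)"
      using J(3) by (intro mult_left_mono power_increasing) auto
    also have "\<dots> = card V ^ (m - card J) * (16 * card W) ^ card J"
      by (simp add: power_mult power_mult_distrib)
    also have "\<dots> \<le> card V ^ (m - card J) * card V ^ card J"
      using W(2) by (intro mult_left_mono power_mono) auto
    also have "\<dots> = card V ^ m"
      using J card_mono[OF _ J(1)] by (simp flip: power_add)
    finally show ?thesis .
  qed
  have "{f \<in> {..<m} \<rightarrow>\<^sub>E V. m \<le> 2 * card {i. i < m \<and> f i \<in> W}} \<subseteq> (\<Union>J\<in>\<J>. \<F> J)"
  proof
    fix f assume f: "f \<in> {f \<in> {..<m} \<rightarrow>\<^sub>E V. m \<le> 2 * card {i. i < m \<and> f i \<in> W}}"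
    then have "{i. i < m \<and> f i \<in> W} \<in> \<J>" "f \<in> \<F> {i. i < m \<and> f i \<in> W}"
      by (auto simp: \<J>_def \<F>_def PiE_iff)
    then show "f \<in> (\<Union>J\<in>\<J>. \<F> J)" by blast
  qed
  moreover have "finite (\<F> J)" for J
    unfolding \<F>_def using V W(1) by (intro finite_PiE) (auto dest: finite_subset)
  ultimately have "card {f \<in> {..<m} \<rightarrow>\<^sub>E V. m \<le> 2 * card {i. i < m \<and> f i \<in> W}} \<le> card (\<Union>J\<in>\<J>. \<F> J)"
    using finJ by (intro card_mono) auto
  also have "\<dots> \<le> (\<Sum>J\<in>\<J>. card (\<F> J))"
    using finJ by (rule card_UN_le)
  finally have "card {f \<in> {..<m} \<rightarrow>\<^sub>E V. m \<le> 2 * card {i. i < m \<and> f i \<in> W}} * 4 ^ m \<le> (\<Sum>J\<in>\<J>. card (\<F> J) * 4 ^ m)"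
    by (simp flip: sum_distrib_right)
  also have "\<dots> \<le> of_nat (card \<J>) * card V ^ m"
    using cardF by (rule sum_bounded_above)
  also have "\<dots> \<le> 2 ^ m * card V ^ m"
  proof -
    have "card \<J> \<le> card (Pow {..<m})"
      by (intro card_mono) (auto simp: \<J>_def)
    then show ?thesis by (simp add: card_Pow)
  qed
  finally have "card {f \<in> {..<m} \<rightarrow>\<^sub>E V. m \<le> 2 * card {i. i < m \<and> f i \<in> W}} * (2 * 2) ^ m \<le> 2 ^ m * card V ^ m"
    by simp
  then show ?thesis
    unfolding power_mult_distrib by simp
qed

text \<open>
  Call a set of \<open>q + 1\<close> indices of an \<open>m\<close>-tuple of points bad if their points lie on a common line. On
  average a tuple has at most \<open>m / 4\<close> bad sets, so at least half of the tuples have at most \<open>m / 2\<close>, and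
  deleting the least index of each leaves at least \<open>m / 2\<close> indices and no bad set. Fewer than half of all
  tuples have at least \<open>m / 2\<close> entries in some \<open>W\<close>. Repetitions in a tuple do no harm: a line with more
  than \<open>q\<close> distinct points gives \<open>q + 1\<close> indices, and \<open>P\<close> only needs at most \<open>m\<close> points.
\<close>
lemma sparse_sample:
  assumes V: "finite V" "V \<noteq> {}" and \<L>: "finite \<L>"
    and k: "\<And>l. l \<in> \<L> \<Longrightarrow> card (l \<inter> V) \<le> k"
    and D: "\<And>z. z \<in> V \<Longrightarrow> card {l \<in> \<L>. z \<in> l} \<le> D"
    and sparse: "4 * D * (m * k) ^ q \<le> card V ^ q"
    and \<W>: "finite \<W>" "2 * card \<W> < 2 ^ m"
      "\<And>W. W \<in> \<W> \<Longrightarrow> W \<subseteq> V \<and> 16 * card W \<le> card V"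
  shows "\<exists>P\<subseteq>V. card P \<le> m \<and> (\<forall>l\<in>\<L>. card (l \<inter> P) \<le> q) \<and> (\<forall>W\<in>\<W>. \<not> P \<subseteq> W)"
proof -
  define \<Omega> where "\<Omega> = {..<m} \<rightarrow>\<^sub>E V"
  define \<T> where "\<T> = {T. T \<subseteq> {..<m} \<and> card T = Suc q}"
  define bad where "bad f = {T \<in> \<T>. \<exists>l\<in>\<L>. f ` T \<subseteq> l}" for f
  have \<Omega>: "finite \<Omega>" "card \<Omega> = card V ^ m"
    using V by (auto simp: \<Omega>_def card_PiE intro: finite_PiE)
  have pos: "0 < card V" using V by (simp add: card_gt_0_iff)
  have \<T>: "finite \<T>" "card \<T> = m choose Suc q"
    using n_subsets[of "{..<m}" "Suc q"] by (auto simp: \<T>_def intro: finite_subset[of _ "Pow {..<m}"])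
  have cardT: "card \<T> \<le> m ^ Suc q"
    unfolding \<T> by (cases "Suc q \<le> m") (auto simp: binomial_eq_0 intro: binomial_le_pow[THEN order_trans])
  have bad_sum: "4 * (\<Sum>f\<in>\<Omega>. card (bad f)) \<le> m * card V ^ m"
  proof -
    have "(\<Sum>f\<in>\<Omega>. card (bad f)) = (\<Sum>f\<in>\<Omega>. \<Sum>T\<in>\<T>. if \<exists>l\<in>\<L>. f ` T \<subseteq> l then 1 else 0)"
      using \<T> by (simp add: bad_def sum.If_cases Int_def)
    also have "\<dots> = (\<Sum>T\<in>\<T>. \<Sum>f\<in>\<Omega>. if \<exists>l\<in>\<L>. f ` T \<subseteq> l then 1 else 0)"
      by (rule sum.swap)
    also have "\<dots> = (\<Sum>T\<in>\<T>. card {f \<in> \<Omega>. \<exists>l\<in>\<L>. f ` T \<subseteq> l})"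
      using \<Omega> by (simp add: sum.If_cases Int_def)
    finally have "(\<Sum>f\<in>\<Omega>. card (bad f)) * card V ^ q
        = (\<Sum>T\<in>\<T>. card {f \<in> \<Omega>. \<exists>l\<in>\<L>. f ` T \<subseteq> l} * card V ^ q)"
      by (simp add: sum_distrib_right)
    also have "\<dots> \<le> of_nat (card \<T>) * (D * k ^ q * card V ^ m)"
      using card_functions_meeting_line[OF V(1) \<L> k D]
      by (intro sum_bounded_above) (auto simp: \<T>_def \<Omega>_def)
    also have "\<dots> \<le> m ^ Suc q * (D * k ^ q * card V ^ m)"
      using cardT by (intro mult_right_mono) simp_all
    also have "\<dots> = (D * (m * k) ^ q) * (m * card V ^ m)"
      by (simp add: power_mult_distrib mult_ac)
    finally have "4 * (\<Sum>f\<in>\<Omega>. card (bad f)) * card V ^ q \<le> (4 * D * (m * k) ^ q) * (m * card V ^ m)"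
      by simp
    also have "\<dots> \<le> card V ^ q * (m * card V ^ m)"
      using sparse by (rule mult_right_mono) simp
    finally have "card V ^ q * (4 * (\<Sum>f\<in>\<Omega>. card (bad f))) \<le> card V ^ q * (m * card V ^ m)"
      by (simp only: mult_ac)
    then show ?thesis
      using pos by simp
  qed
  define B where "B = {f \<in> \<Omega>. m < 2 * card (bad f)}"
  define C where "C W = {f \<in> \<Omega>. m \<le> 2 * card {i. i < m \<and> f i \<in> W}}" for W
  have "2 * card B \<le> card V ^ m"
  proof -
    have "2 * (\<Sum>f\<in>B. Suc m) \<le> 2 * (\<Sum>f\<in>B. 2 * card (bad f))"
      by (intro mult_left_mono sum_mono) (auto simp: B_def)
    also have "\<dots> \<le> 4 * (\<Sum>f\<in>\<Omega>. card (bad f))"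
      using \<Omega> by (auto simp: B_def simp flip: sum_distrib_left intro: sum_mono2)
    also have "\<dots> \<le> Suc m * card V ^ m"
      using bad_sum by simp
    finally have "Suc m * (2 * card B) \<le> Suc m * card V ^ m"
      by (simp only: sum_constant of_nat_id mult_ac)
    then show ?thesis by (simp only: mult_le_cancel1 zero_less_Suc)
  qed
  moreover have "2 * card (\<Union>W\<in>\<W>. C W) < card V ^ m"
  proof -
    have "card (\<Union>W\<in>\<W>. C W) \<le> (\<Sum>W\<in>\<W>. card (C W))"
      using \<W>(1) by (rule card_UN_le)
    then have "2 * card (\<Union>W\<in>\<W>. C W) * 2 ^ m \<le> 2 * (\<Sum>W\<in>\<W>. card (C W) * 2 ^ m)"
      by (simp flip: sum_distrib_right)
    also have "\<dots> \<le> 2 * (of_nat (card \<W>) * card V ^ m)"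
      using \<W>(3) card_functions_mostly_in[OF V(1)] unfolding C_def \<Omega>_def
      by (intro mult_left_mono sum_bounded_above) auto
    also have "\<dots> < 2 ^ m * card V ^ m"
      using \<W>(2) pos by simp
    finally show ?thesis by simp
  qed
  ultimately have "2 * card (B \<union> (\<Union>W\<in>\<W>. C W)) < 2 * card \<Omega>"
    using card_Un_le[of B "\<Union>W\<in>\<W>. C W"] \<Omega>(2) by linarith
  moreover have "B \<union> (\<Union>W\<in>\<W>. C W) \<subseteq> \<Omega>"
    by (auto simp: B_def C_def)
  ultimately have "B \<union> (\<Union>W\<in>\<W>. C W) \<subset> \<Omega>"
    by auto
  then obtain f where f: "f \<in> \<Omega>" "f \<notin> B" "\<And>W. W \<in> \<W> \<Longrightarrow> f \<notin> C W"
    by blast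
  define J where "J = {..<m} - Min ` bad f"
  have finbad: "finite (bad f)"
    using \<T> by (simp add: bad_def)
  have "m \<le> 2 * card J"
  proof -
    have "m \<le> card J + card (Min ` bad f)"
      using diff_card_le_card_Diff[of "Min ` bad f" "{..<m}"] finbad by (simp add: J_def)
    moreover have "card (Min ` bad f) \<le> card (bad f)"
      using finbad by (rule card_image_le)
    ultimately show ?thesis
      using f(1,2) by (simp add: B_def)
  qed
  show ?thesis
  proof (intro exI[of _ "f ` J"] conjI ballI)
    show "f ` J \<subseteq> V"
      using f(1) by (auto simp: \<Omega>_def J_def)
    have "card (f ` J) \<le> card J"
      by (intro card_image_le) (simp add: J_def)
    also have "card J \<le> m"
      using card_mono[of "{..<m}" J] by (simp add: J_def)
    finally show "card (f ` J) \<le> m" .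
    fix l assume l: "l \<in> \<L>"
    show "card (l \<inter> f ` J) \<le> q"
    proof (rule ccontr)
      assume "\<not> card (l \<inter> f ` J) \<le> q"
      then obtain Y where Y: "Y \<subseteq> l \<inter> f ` J" "card Y = Suc q"
        by (metis not_less_eq_eq obtain_subset_with_card_n)
      then obtain T where T: "T \<subseteq> J" "inj_on f T" "Y = f ` T"
        by (metis Int_subset_iff subset_image_inj)
      then have "T \<in> bad f"
        using Y l by (auto simp: bad_def \<T>_def J_def card_image)
      moreover have "Min T \<in> T"
        using Y(2) T by (intro Min_in) (auto intro: card_ge_0_finite simp: card_image)
      ultimately show False
        using T(1) by (auto simp: J_def)
    qed
  next
    fix W assume W: "W \<in> \<W>"
    show "\<not> f ` J \<subseteq> W"
    proof
      assume "f ` J \<subseteq> W"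
      then have "card J \<le> card {i. i < m \<and> f i \<in> W}"
        by (intro card_mono) (auto simp: J_def)
      then show False
        using f(1) f(3)[OF W] \<open>m \<le> 2 * card J\<close> by (simp add: C_def)
    qed
  qed
qed

section \<open>Lines in a planar grid\<close>

definition grid :: "nat \<Rightarrow> nat \<Rightarrow> (int \<times> int) set" where
  "grid k B = {0..<int k} \<times> {0..<int (k * B)}"

text \<open>
  A line has one point in each of the \<open>k\<close> columns, even outside the grid, so that different slopes give
  different sets of points also near the boundary.
\<close>
definition grid_line :: "nat \<Rightarrow> int \<Rightarrow> int \<Rightarrow> (int \<times> int) set" where
  "grid_line k a b = (\<lambda>t. (t, a + b * t)) ` {0..<int k}"

definition grid_lines :: "nat \<Rightarrow> nat \<Rightarrow> (int \<times> int) set set" where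
  "grid_lines k B = (\<lambda>(a, b). grid_line k a b) ` ({- int (k * B)..<int (k * B)} \<times> {0..<int B})"

lemma mem_grid_line: "(t, x) \<in> grid_line k a b \<longleftrightarrow> 0 \<le> t \<and> t < int k \<and> x = a + b * t"
  by (auto simp: grid_line_def)

lemma finite_grid: "finite (grid k B)" and card_grid: "card (grid k B) = k\<^sup>2 * B"
  by (auto simp: grid_def card_cartesian_product power2_eq_square nat_mult_distrib)

lemma finite_grid_lines: "finite (grid_lines k B)"
  by (simp add: grid_lines_def)

lemma card_grid_lines: "card (grid_lines k B) \<le> 2 * k * B\<^sup>2"
proof -
  have "card (grid_lines k B) \<le> card ({- int (k * B)..<int (k * B)} \<times> {0..<int B})"
    unfolding grid_lines_def by (rule card_image_le) simp
  also have "\<dots> = nat (2 * int (k * B)) * B"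
    by (simp add: card_cartesian_product mult_ac)
  also have "nat (2 * int (k * B)) = 2 * (k * B)"
    by (simp only: nat_mult_distrib nat_int) simp
  finally show ?thesis by (simp add: power2_eq_square mult_ac)
qed

lemma card_grid_line_le: "l \<in> grid_lines k B \<Longrightarrow> card (l \<inter> S) \<le> k"
proof -
  assume "l \<in> grid_lines k B"
  then obtain a b where l: "l = grid_line k a b"
    by (auto simp: grid_lines_def)
  have "card (l \<inter> S) \<le> card l"
    by (rule card_mono) (auto simp: l grid_line_def)
  also have "\<dots> \<le> card {0..<int k}"
    unfolding l grid_line_def by (rule card_image_le) simp
  finally show ?thesis by simp
qed

lemma grid_lines_linear:
  assumes l: "l \<in> grid_lines k B" "l' \<in> grid_lines k B" and xy: "x \<noteq> y"
    and mem: "x \<in> l" "x \<in> l'" "y \<in> l" "y \<in> l'"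
  shows "l = l'"
proof -
  obtain a b a' b' where ab: "l = grid_line k a b" "l' = grid_line k a' b'"
    using l by (auto simp: grid_lines_def)
  obtain t u t' u' where x: "x = (t, u)" and y: "y = (t', u')"
    by (cases x, cases y) auto
  have *: "u = a + b * t" "u = a' + b' * t" "u' = a + b * t'" "u' = a' + b' * t'"
    using mem unfolding ab x y mem_grid_line by auto
  have "t \<noteq> t'"
    using xy * x y by auto
  moreover have "(b - b') * (t - t') = 0"
    using * by (simp add: algebra_simps)
  ultimately have "b = b'" by simp
  then show ?thesis using * ab by simp
qed

text \<open>
  Two columns are needed to tell the slopes of two lines through the same point apart.
\<close>
lemma degree_grid_lines:
  assumes k: "2 \<le> k" and z: "z \<in> grid k B"
  shows "card {l \<in> grid_lines k B. z \<in> l} = B"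
proof -
  obtain t x where zt: "z = (t, x)" and t: "0 \<le> t" "t < int k" and x: "0 \<le> x" "x < int (k * B)"
    using z by (auto simp: grid_def)
  define L where "L b = grid_line k (x - b * t) b" for b
  have "{l \<in> grid_lines k B. z \<in> l} = L ` {0..<int B}"
  proof (intro equalityI subsetI)
    fix l assume "l \<in> {l \<in> grid_lines k B. z \<in> l}"
    then obtain a b where "l = grid_line k a b" "b \<in> {0..<int B}" "z \<in> l"
      by (auto simp: grid_lines_def)
    moreover from this have "l = L b"
      by (auto simp: zt mem_grid_line L_def)
    ultimately show "l \<in> L ` {0..<int B}"
      by blast
  next
    fix l assume "l \<in> L ` {0..<int B}"
    then obtain b where b: "0 \<le> b" "b < int B" "l = L b"
      by auto
    have "b * t \<le> int B * int k"
      using b t by (intro mult_mono) auto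
    moreover have "0 \<le> b * t"
      using b t by simp
    ultimately have "x - b * t \<in> {- int (k * B)..<int (k * B)}"
      using x by (auto simp: mult.commute)
    then have "l \<in> grid_lines k B"
      using b by (force simp: grid_lines_def L_def)
    then show "l \<in> {l \<in> grid_lines k B. z \<in> l}"
      using t by (simp add: b zt L_def mem_grid_line)
  qed
  moreover have "inj L"
  proof (rule injI)
    fix b b' assume eq: "L b = L b'"
    define s where "s = (if t = 0 then 1 else 0 :: int)"
    have s: "0 \<le> s" "s < int k" "s \<noteq> t"
      using k by (auto simp: s_def)
    have "(s, x - b * t + b * s) \<in> L b"
      using s by (simp add: mem_grid_line L_def)
    then have "(s, x - b * t + b * s) \<in> L b'"
      using eq by simp
    then have "(b - b') * (s - t) = 0"
      by (simp add: L_def mem_grid_line algebra_simps)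
    then show "b = b'" using s by simp
  qed
  ultimately show ?thesis
    by (simp add: card_image inj_on_subset)
qed

definition embed :: "int \<times> int \<Rightarrow> real ^ 2" where
  "embed z = vector [of_int (fst z), of_int (snd z)]"

lemma inj_embed: "inj embed"
  by (rule injI) (auto simp: embed_def vec_eq_iff forall_2 prod_eq_iff)

lemma is_line_graph: "is_line {p :: real ^ 2. p $ 2 = a + b * p $ 1}"
proof -
  define u v :: "real ^ 2" where "u = vector [0, a]" and "v = vector [1, a + b]"
  have "u $ 1 \<noteq> v $ 1"
    by (simp add: u_def v_def)
  then have "u \<noteq> v" by auto
  have "{p. p $ 2 = a + b * p $ 1} = affine hull {u, v}"
  proof (intro equalityI subsetI)
    fix p :: "real ^ 2" assume "p \<in> {p. p $ 2 = a + b * p $ 1}"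
    then have "p = (1 - p $ 1) *\<^sub>R u + (p $ 1) *\<^sub>R v"
      by (simp add: vec_eq_iff forall_2 u_def v_def algebra_simps)
    moreover have "(1 - p $ 1) + p $ 1 = 1"
      by simp
    ultimately show "p \<in> affine hull {u, v}"
      unfolding affine_hull_2 by blast
  next
    fix p assume "p \<in> affine hull {u, v}"
    then obtain s r where "p = s *\<^sub>R u + r *\<^sub>R v" "s + r = 1"
      by (auto simp: affine_hull_2)
    then have "p $ 1 = r" "p $ 2 = s * a + r * (a + b)" "s = 1 - r"
      by (auto simp: u_def v_def)
    then show "p \<in> {p. p $ 2 = a + b * p $ 1}"
      by (simp add: algebra_simps)
  qed
  then show ?thesis
    using \<open>u \<noteq> v\<close> by (simp add: is_line_def affine_affine_hull aff_dim_2)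
qed

text \<open>
  Grid lines contain every grid point of the real line that they span, so they can be used as hyperedges.
\<close>
lemma grid_line_extends:
  assumes "l \<in> grid_lines k B"
  obtains L where "is_line L" "\<And>z. z \<in> grid k B \<Longrightarrow> embed z \<in> L \<longleftrightarrow> z \<in> l"
proof -
  obtain a b where l: "l = grid_line k a b"
    using assms by (auto simp: grid_lines_def)
  show ?thesis
  proof (rule that[OF is_line_graph[of "of_int a" "of_int b"]])
    fix z assume z: "z \<in> grid k B"
    obtain t x where "z = (t, x)" "0 \<le> t" "t < int k"
      using z by (auto simp: grid_def)
    moreover have "real_of_int x = of_int a + of_int b * of_int t \<longleftrightarrow> x = a + b * t"
      by (metis of_int_add of_int_eq_iff of_int_mult)
    ultimately show "embed z \<in> {p. p $ 2 = of_int a + of_int b * p $ 1} \<longleftrightarrow> z \<in> l"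
      by (simp add: l mem_grid_line embed_def)
  qed
qed

text \<open>
  This is the failure of all colorings of \<open>line_hypergraph q P\<close> with \<open>c\<close> colors, in a form that survives
  the addition of generic points.
\<close>
definition not_colorable :: "nat \<Rightarrow> nat \<Rightarrow> (real ^ 2) set \<Rightarrow> bool" where
  "not_colorable q c P \<longleftrightarrow>
     (\<forall>f. f ` P \<subseteq> {1..c} \<longrightarrow> (\<exists>L. is_line L \<and> q \<le> card (P \<inter> L) \<and> monochromatic f (P \<inter> L)))"

text \<open>
  The line length \<open>k\<close> makes the container theorem reach sets of size \<open>card V / (16 * c)\<close>, \<open>t\<close> bounds the
  length of a phase, and \<open>r\<close> is the number of epochs. The hypotheses \<open>few\<close> and \<open>sparse\<close> are those of
  \<open>sparse_sample\<close> for the unions of \<open>c\<close> containers.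
\<close>
lemma planar_set_not_colorable:
  assumes q: "2 \<le> q" and M: "4 \<le> M" and c: "1 \<le> c"
    and k: "k = 512 * 33 ^ (q - 1) * c"
    and B: "B = M ^ (q - 1)"
    and t: "t = 8 * 33 ^ (q - 1) * k * M ^ (q - 2)"
    and r: "16 * c * (1 - 1 / 2 ^ (q + 1)) ^ r \<le> (1 :: real)"
    and few: "2 * ((k\<^sup>2 * B + 1) ^ (r * ((q - 1) * t))) ^ c < 2 ^ m"
    and sparse: "4 * B * (m * k) ^ q \<le> (k\<^sup>2 * B) ^ q"
  shows "\<exists>P. finite P \<and> card P \<le> m \<and> not_colorable q c P"
proof -
  define V where "V = grid k B"
  define \<L> where "\<L> = grid_lines k B"
  define w where "w = real (card V) / (16 * c)"
  define \<S> where "\<S> = {C. C \<subseteq> V \<and> real (card C) \<le> w}"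
  have k2: "2 \<le> k"
  proof -
    have "512 * 1 * 1 \<le> k"
      unfolding k using c by (intro mult_le_mono) auto
    then show ?thesis by simp
  qed
  have V: "finite V" "card V = k\<^sup>2 * B"
    by (simp_all add: V_def finite_grid card_grid)
  have B0: "0 < B" using M by (simp add: B)
  interpret line_system V \<L> q M \<S>
  proof
    show "l = l'" if "l \<in> \<L>" "l' \<in> \<L>" "x \<noteq> y" "x \<in> l" "x \<in> l'" "y \<in> l" "y \<in> l'" for l l' x y
      using that unfolding \<L>_def by (rule grid_lines_linear)
  qed (use M in \<open>simp_all add: V_def \<L>_def finite_grid finite_grid_lines\<close>)
  have deg: "deg \<L> z = B" if "z \<in> V" for z
    using degree_grid_lines[OF k2] that by (simp add: deg_def V_def \<L>_def)
  have "cov (r * ((q - 1) * t)) (independents {} V)"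
  proof (rule containers)
    show "1 \<le> q" "0 \<le> w"
      using q by (auto simp: w_def)
    show "M ^ (q - 1) \<le> deg \<L> z" if "z \<in> V" for z
      using deg[OF that] B by simp
    have "16 * 33 ^ (q - 1) * real (card \<L>) \<le> 16 * 33 ^ (q - 1) * real (2 * k * B\<^sup>2)"
      unfolding \<L>_def using card_grid_lines by (intro mult_left_mono of_nat_mono) auto
    also have "\<dots> = M ^ (q - 1) * w"
    proof -
      have "real B * w * (16 * c) = B * (real k * real k * B)"
        using c by (simp add: w_def V power2_eq_square)
      also have "\<dots> = B * (real k * (512 * 33 ^ (q - 1) * c) * B)"
        by (subst (2) k) simp
      finally have "real B * w * c = 16 * 33 ^ (q - 1) * real (2 * k * B\<^sup>2) * c"
        by (simp add: power2_eq_square mult_ac)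
      then show ?thesis
        using c B by simp
    qed
    finally show "16 * 33 ^ (q - 1) * real (card \<L>) \<le> M ^ (q - 1) * w" .
    have "4 * 33 ^ (q - 1) * card \<L> \<le> 4 * 33 ^ (q - 1) * (2 * k * B\<^sup>2)"
      unfolding \<L>_def using card_grid_lines by (rule mult_left_mono) simp
    also have "\<dots> = t * M ^ q"
    proof -
      have "B\<^sup>2 = M ^ (q - 2) * M ^ q"
      proof -
        have "(q - 1) * 2 = (q - 2) + q" using q by simp
        then show ?thesis
          unfolding B by (metis power_add power_mult)
      qed
      then show ?thesis by (simp add: t mult_ac)
    qed
    finally show "4 * 33 ^ (q - 1) * card \<L> \<le> t * M ^ q" .
    show "(1 - 1 / 2 ^ (q + 1)) ^ r * real (card V) \<le> w"
    proof -
      have "16 * real c * (1 - 1 / 2 ^ (q + 1)) ^ r * real (card V) \<le> 1 * real (card V)"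
        using r by (rule mult_right_mono) simp
      then show ?thesis
        using c by (simp add: w_def field_simps)
    qed
  qed (simp_all add: \<S>_def)
  then obtain \<C> where \<C>: "\<C> \<subseteq> \<S>" "finite \<C>" "card \<C> \<le> (k\<^sup>2 * B + 1) ^ (r * ((q - 1) * t))"
    and cover: "\<And>I. I \<in> independents {} V \<Longrightarrow> \<exists>C\<in>\<C>. I \<subseteq> C"
    unfolding covered_def V(2) by auto
  define \<W> where "\<W> = (\<lambda>g. \<Union>i\<in>{1..c}. g i) ` ({1..c} \<rightarrow>\<^sub>E \<C>)"
  have fin\<W>: "finite \<W>"
    unfolding \<W>_def using \<C>(2) by (intro finite_imageI finite_PiE) auto
  have "card \<W> \<le> card ({1..c} \<rightarrow>\<^sub>E \<C>)"
    unfolding \<W>_def using \<C>(2) by (intro card_image_le finite_PiE) auto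
  also have "\<dots> = card \<C> ^ c"
    by (simp add: card_PiE)
  also have "\<dots> \<le> ((k\<^sup>2 * B + 1) ^ (r * ((q - 1) * t))) ^ c"
    using \<C>(3) by (rule power_mono) simp
  finally have card\<W>: "2 * card \<W> < 2 ^ m"
    using few by linarith
  have small\<W>: "W \<subseteq> V \<and> 16 * card W \<le> card V" if W: "W \<in> \<W>" for W
  proof -
    obtain g where g: "g \<in> {1..c} \<rightarrow>\<^sub>E \<C>" "W = (\<Union>i\<in>{1..c}. g i)"
      using W unfolding \<W>_def by blast
    have gi: "g i \<subseteq> V" "real (card (g i)) \<le> w" if "i \<in> {1..c}" for i
    proof -
      have "g i \<in> \<S>"
        using g(1) that \<C>(1) by (meson PiE_mem subsetD)
      then show "g i \<subseteq> V" "real (card (g i)) \<le> w"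
        by (auto simp: \<S>_def)
    qed
    have "card W \<le> (\<Sum>i\<in>{1..c}. card (g i))"
      unfolding g(2) by (rule card_UN_le) simp
    then have "real (card W) \<le> (\<Sum>i\<in>{1..c}. real (card (g i)))"
      by (metis of_nat_mono of_nat_sum)
    also have "\<dots> \<le> of_nat (card {1..c}) * w"
      using gi(2) by (rule sum_bounded_above)
    also have "\<dots> = real (card V) / 16"
      using c by (simp add: w_def)
    finally have "16 * card W \<le> card V"
      by linarith
    moreover have "W \<subseteq> V"
      unfolding g(2) using gi(1) by (rule UN_least)
    ultimately show ?thesis by blast
  qed
  have "V \<noteq> {}"
    using V k2 B0 by auto
  have "\<exists>P\<subseteq>V. card P \<le> m \<and> (\<forall>l\<in>\<L>. card (l \<inter> P) \<le> q) \<and> (\<forall>W\<in>\<W>. \<not> P \<subseteq> W)"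
  proof (rule sparse_sample[OF V(1) \<open>V \<noteq> {}\<close> finite_lines _ _ _ fin\<W> card\<W> small\<W>])
    show "card (l \<inter> V) \<le> k" if "l \<in> \<L>" for l
      using card_grid_line_le that by (simp add: \<L>_def)
    show "card {l \<in> \<L>. z \<in> l} \<le> B" if "z \<in> V" for z
      using deg[OF that] by (simp add: deg_def)
    show "4 * B * (m * k) ^ q \<le> card V ^ q"
      using sparse V by simp
  qed
  then obtain P0 where P0: "P0 \<subseteq> V" "card P0 \<le> m" "\<forall>l\<in>\<L>. card (l \<inter> P0) \<le> q"
    "\<forall>W\<in>\<W>. \<not> P0 \<subseteq> W"
    by blast
  have finP0: "finite P0"
    using P0(1) V(1) by (rule finite_subset)
  have "not_colorable q c (embed ` P0)"
    unfolding not_colorable_def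
  proof (intro allI impI)
    fix f :: "real ^ 2 \<Rightarrow> nat" assume f: "f ` embed ` P0 \<subseteq> {1..c}"
    define I where "I i = {z \<in> P0. f (embed z) = i}" for i
    show "\<exists>L. is_line L \<and> q \<le> card (embed ` P0 \<inter> L) \<and> monochromatic f (embed ` P0 \<inter> L)"
    proof (rule ccontr)
      assume none: "\<not> ?thesis"
      have "I i \<in> independents {} V" for i
      proof -
        have "card (l \<inter> I i) < q" if l: "l \<in> \<L>" for l
        proof (rule ccontr)
          assume "\<not> card (l \<inter> I i) < q"
          then have "card (l \<inter> P0) \<le> card (l \<inter> I i)"
            using P0(3) l by (meson le_trans not_less)
          \<comment> \<open>The line has at most \<open>q\<close> points in all, so its \<open>q\<close> points of color \<open>i\<close> are all of them.\<close>
          then have eq: "l \<inter> I i = l \<inter> P0"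
            using finP0 by (intro card_seteq) (auto simp: I_def)
          obtain L where L: "is_line L" "\<And>z. z \<in> V \<Longrightarrow> embed z \<in> L \<longleftrightarrow> z \<in> l"
            using grid_line_extends l unfolding \<L>_def V_def by blast
          have PL: "embed ` P0 \<inter> L = embed ` (l \<inter> P0)"
            using L(2) P0(1) by auto
          have "q \<le> card (embed ` P0 \<inter> L)"
            using \<open>\<not> card (l \<inter> I i) < q\<close> eq inj_embed
            by (simp add: PL card_image inj_on_subset)
          moreover have "monochromatic f (embed ` P0 \<inter> L)"
            unfolding PL monochromatic_def eq[symmetric] by (auto simp: I_def)
          ultimately show False
            using none L(1) by blast
        qed
        then show ?thesis
          using P0(1) by (auto simp: independents_def I_def)
      qed
      then have "\<forall>i. \<exists>C. C \<in> \<C> \<and> I i \<subseteq> C"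
        using cover by blast
      then obtain C where C: "\<And>i. C i \<in> \<C> \<and> I i \<subseteq> C i"
        by metis
      have "P0 \<subseteq> (\<Union>i\<in>{1..c}. (restrict C {1..c}) i)"
      proof
        fix z assume z: "z \<in> P0"
        then have "f (embed z) \<in> {1..c}"
          using f by blast
        moreover have "z \<in> I (f (embed z))"
          using z by (simp add: I_def)
        ultimately show "z \<in> (\<Union>i\<in>{1..c}. (restrict C {1..c}) i)"
          using C by (intro UN_I[of "f (embed z)"]) auto
      qed
      moreover have "(\<Union>i\<in>{1..c}. (restrict C {1..c}) i) \<in> \<W>"
        unfolding \<W>_def using C by (intro imageI) auto
      ultimately show False
        using P0(4) by blast
    qed
  qed
  moreover have "finite (embed ` P0)" "card (embed ` P0) \<le> m"
    using finP0 P0(2) card_image_le[OF finP0, of embed] by auto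
  ultimately show ?thesis by blast
qed

section \<open>From point sets to the chromatic number\<close>

lemma line_unique:
  assumes "is_line L" "x \<in> L" "y \<in> L" "x \<noteq> y"
  shows "L = affine hull {x, y}"
proof (rule affine_dim_equal[symmetric])
  show "affine hull {x, y} \<subseteq> L"
    using assms by (intro hull_minimal) (auto simp: is_line_def)
qed (use assms in \<open>auto simp: is_line_def affine_affine_hull\<close>)

lemma negligible_line:
  assumes "is_line L"
  shows "negligible L"
proof -
  have "convex L" "aff_dim L \<noteq> int (DIM(real ^ 2))"
    using assms by (simp_all add: is_line_def affine_imp_convex)
  then show ?thesis
    using aff_dim_nonempty_interior[of L] negligible_convex_interior by blast
qed

text \<open>
  A new point off the finitely many lines through two points of \<open>P\<close> leaves every hyperedge with at least
  two points unchanged.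
\<close>
lemma not_colorable_insert:
  assumes P: "finite P" "not_colorable q c P" and q: "2 \<le> q"
  obtains z where "z \<notin> P" "not_colorable q c (insert z P)"
proof -
  define \<A> where "\<A> = {L. is_line L \<and> (\<exists>x\<in>P. \<exists>y\<in>P. x \<noteq> y \<and> x \<in> L \<and> y \<in> L)}"
  have "\<A> \<subseteq> (\<lambda>(x, y). affine hull {x, y}) ` (P \<times> P)"
  proof
    fix L assume "L \<in> \<A>"
    then obtain x y where "x \<in> P" "y \<in> P" "L = affine hull {x, y}"
      using line_unique by (auto simp: \<A>_def)
    then show "L \<in> (\<lambda>(x, y). affine hull {x, y}) ` (P \<times> P)" by auto
  qed
  then have "finite \<A>"
    using P(1) by (meson finite_SigmaI finite_imageI finite_subset)
  then have "negligible (\<Union>\<A> \<union> P)"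
    using P(1) negligible_line by (intro negligible_Un negligible_Union) (auto simp: \<A>_def negligible_finite)
  then obtain z where z: "z \<notin> \<Union>\<A> \<union> P"
    using non_negligible_UNIV by (metis UNIV_eq_I)
  have "not_colorable q c (insert z P)"
    unfolding not_colorable_def
  proof (intro allI impI)
    fix f :: "real ^ 2 \<Rightarrow> nat" assume "f ` insert z P \<subseteq> {1..c}"
    then obtain L where L: "is_line L" "q \<le> card (P \<inter> L)" "monochromatic f (P \<inter> L)"
      using P(2) unfolding not_colorable_def by (metis image_mono subset_insertI subset_trans)
    have "2 \<le> card (P \<inter> L)"
      using L(2) q by simp
    then obtain x y where "x \<in> P \<inter> L" "y \<in> P \<inter> L" "x \<noteq> y"
      by (metis card_2_iff obtain_subset_with_card_n insert_subset)
    then have "L \<in> \<A>"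
      using L(1) by (auto simp: \<A>_def)
    then have "insert z P \<inter> L = P \<inter> L"
      using z by auto
    then show "\<exists>L. is_line L \<and> q \<le> card (insert z P \<inter> L) \<and> monochromatic f (insert z P \<inter> L)"
      using L by metis
  qed
  then show ?thesis using z that by blast
qed

lemma not_colorable_extend:
  assumes "finite P" "not_colorable q c P" "2 \<le> q" "card P \<le> m"
  shows "\<exists>P'. finite P' \<and> card P' = m \<and> not_colorable q c P'"
  using assms
proof (induction "m - card P" arbitrary: P)
  case 0
  then show ?case by (intro exI[of _ P]) simp
next
  case (Suc n)
  obtain z where "z \<notin> P" "not_colorable q c (insert z P)"
    using not_colorable_insert Suc.prems by blast
  then show ?case
    using Suc by (intro Suc.hyps(1)[of "insert z P"]) auto
qed

lemma less_g_lines: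
  assumes P: "finite P" "not_colorable q c P" "card P \<le> m" and q: "2 \<le> q"
  shows "c < g_lines q m"
proof -
  obtain P' where P': "finite P'" "card P' = m" "not_colorable q c P'"
    using not_colorable_extend[OF P(1,2) q P(3)] by blast
  define n where "n = chromatic_number (line_hypergraph q P')"
  have "\<exists>f. proper_coloring (line_hypergraph q P') n f"
    unfolding n_def chromatic_number_def
    by (rule LeastI) (rule ex_proper_coloring_line_hypergraph[OF q P'(1)])
  then obtain f where f: "proper_coloring (line_hypergraph q P') n f" ..
  have "c < n"
  proof (rule ccontr)
    assume "\<not> c < n"
    moreover have "f ` P' \<subseteq> {1..n}"
      using f by (simp add: proper_coloring_def line_hypergraph_def)
    ultimately have "f ` P' \<subseteq> {1..c}"
      by (meson atLeastatMost_subset_iff not_less order_refl order_trans)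
    then obtain L where "is_line L" "q \<le> card (P' \<inter> L)" "monochromatic f (P' \<inter> L)"
      using P'(3) unfolding not_colorable_def by blast
    then show False
      using f by (auto simp: proper_coloring_def line_hypergraph_def)
  qed
  also have "n \<le> g_lines q m"
    unfolding g_lines_def n_def
    using P' by (intro Max_ge finite_line_chromatic_numbers q) blast
  finally show ?thesis .
qed

lemma g_lines_pos:
  assumes "2 \<le> q" "1 \<le> m"
  shows "0 < g_lines q m"
  by (rule less_g_lines[of "{0}"]) (use assms in \<open>auto simp: not_colorable_def\<close>)

section \<open>Choice of parameters\<close>

text \<open>
  The quotient of logarithms is negative for \<open>m = 2\<close>. There \<open>powr\<close> takes the power of the absolute
  value, which is still far below what the hypothesis demands; for \<open>m < 2\<close> the quotient is \<open>0\<close>.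
\<close>
lemma size_hypothesis:
  fixes \<eta> :: real and q m :: nat
  assumes \<eta>: "\<eta> < 1" "0 < \<eta>" and q: "3 \<le> q"
    and size: "real q \<le> 0.005 * \<eta> * (ln (real m) / ln (ln (real m))) powr (1 / 4)"
  shows "3 \<le> m" "1 \<le> ln (ln (real m))" "(200 * real q) ^ 4 * ln (ln (real m)) \<le> ln (real m)"
proof -
  define L where "L = ln (real m)"
  define x where "x = L / ln L"
  define y where "y = x powr (1 / 4)"
  have "\<eta> * y \<le> 1 * y"
    using \<eta> by (intro mult_right_mono) (auto simp: y_def)
  then have y: "200 * real q \<le> y"
    using size by (simp add: y_def x_def L_def)
  then have y600: "600 \<le> y"
    using q by simp
  then have "x \<noteq> 0"
    by (auto simp: y_def)
  then have "L \<noteq> 0"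
    by (auto simp: x_def)
  then have "m \<noteq> 0" "m \<noteq> 1"
    unfolding L_def by (metis ln_0 of_nat_0, metis ln_one of_nat_1)
  moreover have "m \<noteq> 2"
  proof
    assume m: "m = 2"
    have L: "0 < L" "L \<le> 25 / 36"
      using ln2_le_25_over_36 unfolding L_def m by simp_all
    then have "ln L \<le> - 11 / 36"
      using ln_le_minus_one[of L] by linarith
    then have "- x \<le> 4" "0 < - x"
      using L by (auto simp: x_def field_simps)
    then have "ln x \<le> ln 4"
      using ln_minus[of x] by (metis ln_le_cancel_iff zero_less_numeral)
    also have "ln 4 \<le> (4::real)"
      using ln_le_minus_one[of "4::real"] by simp
    finally have "y \<le> exp 1"
      using \<open>x \<noteq> 0\<close> by (simp add: y_def powr_def)
    then show False
      using y600 exp_le by linarith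
  qed
  ultimately show m: "3 \<le> m"
    by linarith
  have "1 - 272 / 300 \<le> ln (3 / exp (1::real))"
  proof -
    have "- ln (3 / exp (1::real)) = ln (exp 1 / 3)"
      by (simp add: ln_div)
    also have "\<dots> \<le> exp 1 / 3 - 1"
      by (rule ln_le_minus_one) simp
    finally show ?thesis
      using e_less_272 by linarith
  qed
  then have "1.09 \<le> ln (3::real)"
    by (simp add: ln_div)
  also have "ln 3 \<le> L"
    using m by (simp add: L_def)
  finally have L: "1.09 \<le> L" .
  have lnL: "0.08 \<le> ln L"
  proof -
    have "- ln L \<le> 1 / L - 1"
      using ln_le_minus_one[of "1 / L"] L by (simp add: ln_div)
    also have "1 / L \<le> 1 / 1.09"
      using L by (intro divide_left_mono) auto
    finally show ?thesis by simp
  qed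
  have "x > 0"
    using L lnL by (simp add: x_def)
  then have "y ^ 4 = x"
    by (simp add: y_def powr_power)
  moreover have "(200 * real q) ^ 4 \<le> y ^ 4"
    using y by (intro power_mono) auto
  ultimately have "(200 * real q) ^ 4 * ln L \<le> x * ln L"
    using lnL by (intro mult_right_mono) auto
  also have "x * ln L = L"
    using lnL by (simp add: x_def)
  finally have main: "(200 * real q) ^ 4 * ln L \<le> L" .
  then show "(200 * real q) ^ 4 * ln (ln (real m)) \<le> ln (real m)"
    by (simp only: L_def)
  have "600 ^ 4 * 0.08 \<le> (200 * real q) ^ 4 * ln L"
    using q lnL by (intro mult_mono power_mono) auto
  moreover have "(3 :: real) \<le> 600 ^ 4 * 0.08"
    by simp
  ultimately have "exp 1 \<le> L"
    using main exp_le by linarith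
  then show "1 \<le> ln (ln (real m))"
    using L by (simp add: ln_ge_iff flip: L_def)
qed

text \<open>
  On taking logarithms the left-hand side becomes \<open>(q\<^sup>2 - 2 * q + 2) * ln c\<close> plus terms of order
  \<open>q ^ 3 * ln (ln m)\<close>. The first part is at most \<open>(1 - 1 / (2 * q)) * ln m\<close>, and the hypothesis says that
  \<open>ln m / (2 * q)\<close> is a large multiple of \<open>q ^ 3 * ln (ln m)\<close>.
\<close>
lemma parameters_fit:
  fixes q m c :: nat
  defines "\<Lambda> \<equiv> nat \<lceil>log 2 (real m)\<rceil>"
  defines "E \<equiv> 2 ^ (13 * q + 8) * \<Lambda>\<^sup>2"
  assumes q: "3 \<le> q" and m: "3 \<le> m" and lnln: "1 \<le> ln (ln (real m))"
    and size: "(200 * real q) ^ 4 * ln (ln (real m)) \<le> ln (real m)"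
    and c: "1 \<le> c" "ln (real c) * ((real q)\<^sup>2 - real q) \<le> ln (real m)"
  shows "E * c\<^sup>2 * (4 * (2 ^ q * E * c) ^ q) ^ (q - 2) \<le> m" "m \<le> 2 ^ \<Lambda>" "1 \<le> \<Lambda>"
proof -
  define L where "L = ln (real m)"
  define Q where "Q = real q"
  define l where "l = ln L"
  define x where "x = ln (real E)"
  have Q: "3 \<le> Q" using q by (simp add: Q_def)
  have l: "1 \<le> l" using lnln by (simp add: l_def L_def)
  have LQ: "1600000000 * (Q ^ 4 * l) \<le> L"
    using size by (simp add: Q_def l_def L_def power_mult_distrib)
  have "1 * 1 \<le> Q ^ 4 * l"
    using Q l by (intro mult_mono one_le_power) auto
  then have L: "2 \<le> L"
    using LQ by linarith
  have log_pos: "1 \<le> log 2 (real m)"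
    using m by (simp add: le_log_iff)
  then show \<Lambda>1: "1 \<le> \<Lambda>"
    unfolding \<Lambda>_def by linarith
  have "real m = 2 powr (log 2 (real m))"
    using m by simp
  also have "\<dots> \<le> 2 powr real \<Lambda>"
    unfolding \<Lambda>_def using log_pos by (intro powr_mono) linarith+
  finally have "real m \<le> real (2 ^ \<Lambda>)"
    by (simp add: powr_realpow)
  then show "m \<le> 2 ^ \<Lambda>"
    by (simp only: of_nat_le_iff)
  have "real \<Lambda> \<le> log 2 (real m) + 1"
    unfolding \<Lambda>_def using log_pos by linarith
  moreover have "log 2 (real m) = L / ln 2"
    by (simp add: log_def L_def)
  moreover have "L / ln 2 \<le> 3 / 2 * L"
  proof -
    have "L * (2 / 3) \<le> L * ln 2"
      using L ln2_ge_two_thirds by (intro mult_left_mono) auto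
    then show ?thesis
      by (simp add: divide_le_eq)
  qed
  ultimately have "real \<Lambda> \<le> 3 / 2 * L + 1"
    by linarith
  then have "real \<Lambda> \<le> 2 * L"
    using L by linarith
  then have "ln (real \<Lambda>) \<le> ln (2 * L)"
    using \<Lambda>1 L by simp
  also have "\<dots> \<le> 1 + l"
    using L ln_le_minus_one[of 2] by (simp add: ln_mult l_def)
  finally have \<Lambda>: "ln (real \<Lambda>) \<le> 1 + l" .
  have ln2: "ln (2::real) \<le> 1"
    using ln_le_minus_one[of 2] by simp
  have E0: "0 < E"
    using \<Lambda>1 by (simp add: E_def)
  have "x = (13 * Q + 8) * ln 2 + 2 * ln (real \<Lambda>)"
    using \<Lambda>1 by (simp add: x_def E_def ln_mult ln_realpow Q_def)
  also have "\<dots> \<le> (13 * Q + 8) * 1 + 2 * (1 + l)"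
    using \<Lambda> ln2 Q by (intro add_mono mult_left_mono) auto
  finally have x: "x \<le> 17 * Q + 2 * l"
    using Q by simp
  have x0: "0 \<le> x"
    using E0 by (simp add: x_def)
  have "ln (real (E * c\<^sup>2 * (4 * (2 ^ q * E * c) ^ q) ^ (q - 2)))
      = x + 2 * ln c + (Q - 2) * (ln 4 + Q * (Q * ln 2 + x + ln c))"
    using E0 c(1) q by (simp add: ln_mult ln_realpow x_def Q_def of_nat_diff ring_distribs)
  also have "\<dots> = ln c * (Q\<^sup>2 - 2 * Q + 2) + x * (Q\<^sup>2 - 2 * Q + 1) + (Q - 2) * ln 4 + Q * Q * (Q - 2) * ln 2"
    by (simp add: algebra_simps power2_eq_square)
  also have "\<dots> \<le> (L - L / (2 * Q)) + (17 * Q + 2 * l) * Q\<^sup>2 + Q * 3 + Q * Q * Q * 1"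
  proof (intro add_mono)
    have "ln c * (Q\<^sup>2 - 2 * Q + 2) \<le> (L / (Q\<^sup>2 - Q)) * (Q\<^sup>2 - 2 * Q + 2)"
    proof (rule mult_right_mono)
      have "0 < Q * (Q - 1)" using Q by simp
      then show "ln c \<le> L / (Q\<^sup>2 - Q)"
        using c(2) by (simp add: Q_def L_def field_simps power2_eq_square)
      have "0 \<le> (Q - 1)\<^sup>2 + 1" by simp
      then show "0 \<le> Q\<^sup>2 - 2 * Q + 2" by (simp add: power2_diff)
    qed
    also have "\<dots> \<le> L - L / (2 * Q)"
    proof -
      have "2 * Q * (Q\<^sup>2 - 2 * Q + 2) \<le> (2 * Q - 1) * (Q\<^sup>2 - Q)"
        using mult_right_mono[of 3 Q Q] Q by (simp add: algebra_simps power2_eq_square)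
      then have "(Q\<^sup>2 - 2 * Q + 2) / (Q\<^sup>2 - Q) \<le> (2 * Q - 1) / (2 * Q)"
        using Q by (simp add: divide_le_eq le_divide_eq power2_eq_square mult_ac)
      then have "L * ((Q\<^sup>2 - 2 * Q + 2) / (Q\<^sup>2 - Q)) \<le> L * ((2 * Q - 1) / (2 * Q))"
        using L by (intro mult_left_mono) auto
      then show ?thesis
        using Q by (simp add: field_simps)
    qed
    finally show "ln c * (Q\<^sup>2 - 2 * Q + 2) \<le> L - L / (2 * Q)" .
    show "x * (Q\<^sup>2 - 2 * Q + 1) \<le> (17 * Q + 2 * l) * Q\<^sup>2"
      using x x0 Q l zero_le_power2[of "Q - 1"] by (intro mult_mono) (auto simp: power2_diff)
    show "(Q - 2) * ln 4 \<le> Q * 3"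
      using Q ln_le_minus_one[of "4::real"] by (intro mult_mono) auto
    show "Q * Q * (Q - 2) * ln 2 \<le> Q * Q * Q * 1"
      using Q ln2 by (intro mult_mono) auto
  qed
  also have "\<dots> \<le> L"
  proof -
    have "Q\<^sup>2 * l \<le> Q ^ 3 * l" "Q ^ 3 * 1 \<le> Q ^ 3 * l" "Q * 1 \<le> Q ^ 3 * l"
    proof -
      show "Q\<^sup>2 * l \<le> Q ^ 3 * l"
        using Q l by (intro mult_right_mono power_increasing) auto
      show "Q ^ 3 * 1 \<le> Q ^ 3 * l"
        using Q l by (intro mult_left_mono) auto
      have "Q ^ 1 \<le> Q ^ 3"
        using Q by (intro power_increasing) auto
      then show "Q * 1 \<le> Q ^ 3 * l"
        using Q l by (intro mult_mono) auto
    qed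
    then have "(17 * Q + 2 * l) * Q\<^sup>2 + Q * 3 + Q * Q * Q * 1 \<le> 23 * (Q ^ 3 * l)"
      by (simp add: algebra_simps power2_eq_square power3_eq_cube)
    also have "\<dots> \<le> 1600000000 * (Q ^ 4 * l) / (2 * Q)"
      using Q l by (simp add: power_eq_if)
    also have "\<dots> \<le> L / (2 * Q)"
      using LQ Q by (intro divide_right_mono) auto
    finally show ?thesis by simp
  qed
  finally have "ln (real (E * c\<^sup>2 * (4 * (2 ^ q * E * c) ^ q) ^ (q - 2))) \<le> ln (real m)"
    by (simp only: L_def)
  then have "real (E * c\<^sup>2 * (4 * (2 ^ q * E * c) ^ q) ^ (q - 2)) \<le> real m"
    using E0 c(1) m by (subst (asm) ln_le_cancel_iff) simp_all
  then show "E * c\<^sup>2 * (4 * (2 ^ q * E * c) ^ q) ^ (q - 2) \<le> m"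
    by (simp only: of_nat_le_iff)
qed

text \<open>
  Since \<open>(1 - 1 / n) ^ n \<le> exp (- 1) \<le> 1 / 2\<close>, every \<open>n\<close> epochs that remove a fraction \<open>1 / n\<close> each
  halve the number of points.
\<close>
lemma power_shrink_le:
  assumes "0 < n"
  shows "(1 - 1 / real n) ^ (n * \<Lambda>) \<le> 1 / 2 ^ \<Lambda>"
proof -
  have "(1 - 1 / real n) ^ n \<le> exp (- 1 / real n) ^ n"
    using assms exp_ge_add_one_self[of "- 1 / real n"] by (intro power_mono) auto
  also have "\<dots> = exp (- 1)"
    using assms by (simp flip: exp_of_nat_mult)
  also have "\<dots> \<le> 1 / 2"
    using exp_ge_add_one_self[of 1] by (simp add: exp_minus field_simps)
  finally have "((1 - 1 / real n) ^ n) ^ \<Lambda> \<le> (1 / 2) ^ \<Lambda>"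
    using assms by (intro power_mono) auto
  then show ?thesis
    by (simp add: power_mult power_one_over)
qed

text \<open>
  \<open>M\<close> is chosen as large as the number of containers permits, that is, with
  \<open>E * c\<^sup>2 * M ^ (q - 2) \<le> m\<close>. By maximality \<open>m\<close> is then at most a constant times
  \<open>E * c\<^sup>2 * M ^ (q - 2)\<close>, and the sparsity condition \<open>4 * B * (m * k) ^ q \<le> (k\<^sup>2 * B) ^ q\<close> reduces to the
  lower bound \<open>4 * (2 ^ q * E * c) ^ q \<le> M\<close>, which holds because that value is itself small enough to be
  admissible.
\<close>
lemma colors_less_g_lines:
  fixes q m c \<Lambda> :: nat
  defines "E \<equiv> 2 ^ (13 * q + 8) * \<Lambda>\<^sup>2"
  assumes q: "3 \<le> q" and c: "1 \<le> c" and \<Lambda>: "1 \<le> \<Lambda>" "m \<le> 2 ^ \<Lambda>"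
    and fits: "E * c\<^sup>2 * (4 * (2 ^ q * E * c) ^ q) ^ (q - 2) \<le> m"
  shows "c < g_lines q m"
proof -
  define M0 where "M0 = 4 * (2 ^ q * E * c) ^ q"
  define admissible where "admissible M \<longleftrightarrow> E * c\<^sup>2 * M ^ (q - 2) \<le> m" for M
  define M where "M = (GREATEST M. admissible M)"
  have Ec: "1 \<le> E" "1 \<le> E * c\<^sup>2"
    using \<Lambda>(1) c by (simp_all add: E_def)
  have le_m: "M \<le> m" if "admissible M" for M
  proof (cases "M = 0")
    case False
    have "M \<le> M ^ (q - 2)"
      using False q by (intro self_le_power) auto
    also have "\<dots> \<le> E * c\<^sup>2 * M ^ (q - 2)"
      using Ec(2) by simp
    finally show ?thesis
      using that by (simp add: admissible_def)
  qed simp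
  have M0: "admissible M0"
    using fits by (simp add: admissible_def M0_def)
  have M: "admissible M"
    unfolding M_def by (rule GreatestI_nat[of admissible, OF M0]) (rule le_m)
  have "M0 \<le> M"
    unfolding M_def by (rule Greatest_le_nat[of admissible, OF M0]) (rule le_m)
  have "\<not> admissible (Suc M)"
    using Greatest_le_nat[of admissible "Suc M" m] le_m unfolding M_def by fastforce
  have M4: "4 \<le> M"
  proof -
    have "1 \<le> (2 ^ q * E * c) ^ q"
      using Ec(1) c by (intro one_le_power) simp
    then show ?thesis
      using \<open>M0 \<le> M\<close> by (simp add: M0_def)
  qed
  define k where "k = 512 * 33 ^ (q - 1) * c"
  define B where "B = M ^ (q - 1)"
  define t where "t = 8 * 33 ^ (q - 1) * k * M ^ (q - 2)"
  define r where "r = 2 ^ (q + 1) * \<Lambda>"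
  define Y where "Y = c\<^sup>2 * M ^ (q - 2)"
  have Y: "E * Y \<le> m" "1 \<le> Y"
    using M M4 c by (auto simp: admissible_def Y_def)
  have M_step: "M ^ (q - 1) = M * M ^ (q - 2)"
    using q by (metis Suc_diff_le diff_Suc_Suc numeral_2_eq_2 numeral_3_eq_3 One_nat_def Suc_le_lessD less_imp_le power_Suc)
  have pow33: "(33 ^ (q - 1))\<^sup>2 \<le> (2 :: nat) ^ (11 * (q - 1))"
  proof -
    have "(33 ^ (q - 1))\<^sup>2 = ((33 :: nat)\<^sup>2) ^ (q - 1)"
      by (simp only: power_mult[symmetric] mult.commute)
    also have "\<dots> \<le> (2 ^ 11) ^ (q - 1)"
      by (intro power_mono) simp_all
    finally show ?thesis
      by (simp only: power_mult)
  qed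
  \<comment> \<open>Here \<open>card V = k\<^sup>2 * B\<close> is at most \<open>m\<^sup>2\<close>, so a step of the decision tree costs \<open>3 * \<Lambda>\<close> bits.\<close>
  have sample: "2 * ((k\<^sup>2 * B + 1) ^ (r * ((q - 1) * t))) ^ c < 2 ^ m"
  proof -
    have "k\<^sup>2 * M ^ (q - 2) = 2 ^ 18 * (33 ^ (q - 1))\<^sup>2 * Y"
      by (simp add: k_def Y_def power_mult_distrib)
    also have "\<dots> \<le> 2 ^ 18 * 2 ^ (11 * (q - 1)) * Y"
      using pow33 by (intro mult_mono) simp_all
    also have "\<dots> \<le> 2 ^ (13 * q + 8) * Y"
      unfolding power_add[symmetric] using q by (intro mult_right_mono power_increasing) auto
    also have "\<dots> \<le> E * Y"
      using \<Lambda>(1) by (simp add: E_def)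
    finally have "k\<^sup>2 * M ^ (q - 2) \<le> m"
      using Y(1) by linarith
    then have "k\<^sup>2 * B \<le> m * m"
      using mult_mono[of "k\<^sup>2 * M ^ (q - 2)" m M m] le_m[OF M]
      unfolding B_def M_step by (simp add: mult_ac)
    also have "\<dots> \<le> 2 ^ \<Lambda> * 2 ^ \<Lambda>"
      using \<Lambda>(2) by (intro mult_mono) auto
    finally have "k\<^sup>2 * B \<le> 2 ^ \<Lambda> * 2 ^ \<Lambda>" .
    moreover have "(1 :: nat) \<le> 2 ^ \<Lambda> * 2 ^ \<Lambda>"
      by simp
    ultimately have "k\<^sup>2 * B + 1 \<le> 2 * (2 ^ \<Lambda> * 2 ^ \<Lambda>)"
      by linarith
    also have "\<dots> \<le> 2 ^ \<Lambda> * (2 ^ \<Lambda> * 2 ^ \<Lambda>)"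
      using \<Lambda>(1) self_le_power[of "2 :: nat" \<Lambda>] by (intro mult_right_mono) auto
    also have "\<dots> = 2 ^ (3 * \<Lambda>)"
      by (simp add: power_add[symmetric])
    finally have N: "k\<^sup>2 * B + 1 \<le> 2 ^ (3 * \<Lambda>)" .
    have exponent: "3 * \<Lambda> * (r * ((q - 1) * t)) * c + 1 < m"
    proof -
      have "3 * \<Lambda> * (r * ((q - 1) * t)) * c
          = 3 * (2 ^ (q + 1) * (q - 1) * (2 ^ 12 * (33 ^ (q - 1))\<^sup>2)) * (\<Lambda>\<^sup>2 * Y)"
        by (simp add: r_def t_def k_def Y_def power2_eq_square mult_ac)
      also have "\<dots> \<le> 4 * (2 ^ (q + 1) * 2 ^ q * (2 ^ 12 * 2 ^ (11 * (q - 1)))) * (\<Lambda>\<^sup>2 * Y)"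
      proof (intro mult_mono pow33)
        show "q - 1 \<le> 2 ^ q"
          using less_exp[of q] by linarith
      qed simp_all
      also have "\<dots> = 2 ^ (2 + (q + 1 + q + (12 + 11 * (q - 1)))) * (\<Lambda>\<^sup>2 * Y)"
        unfolding power_add by simp
      also have "\<dots> \<le> 2 ^ (13 * q + 6) * (\<Lambda>\<^sup>2 * Y)"
        using q by (intro mult_right_mono power_increasing) auto
      finally have "3 * \<Lambda> * (r * ((q - 1) * t)) * c \<le> 2 ^ (13 * q + 6) * (\<Lambda>\<^sup>2 * Y)" .
      moreover have "1 * 1 \<le> 2 ^ (13 * q + 6) * (\<Lambda>\<^sup>2 * Y)"
        using \<Lambda>(1) Y(2) by (intro mult_le_mono) auto
      moreover have "4 * (2 ^ (13 * q + 6) * (\<Lambda>\<^sup>2 * Y)) = E * Y"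
        by (simp add: E_def power_add)
      ultimately show ?thesis
        using Y(1) by linarith
    qed
    have "2 * ((k\<^sup>2 * B + 1) ^ (r * ((q - 1) * t))) ^ c
        \<le> 2 * ((2 ^ (3 * \<Lambda>)) ^ (r * ((q - 1) * t))) ^ c"
      using N by (intro mult_left_mono power_mono) auto
    also have "\<dots> = 2 ^ (3 * \<Lambda> * (r * ((q - 1) * t)) * c + 1)"
      by (simp only: power_mult[symmetric] power_add power_one_right mult.commute)
    also have "\<dots> < 2 ^ m"
      using exponent by (rule power_strict_increasing) simp
    finally show ?thesis .
  qed
  have sparse: "4 * B * (m * k) ^ q \<le> (k\<^sup>2 * B) ^ q"
  proof -
    have "m \<le> E * c\<^sup>2 * Suc M ^ (q - 2)"
      using \<open>\<not> admissible (Suc M)\<close> by (simp add: admissible_def)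
    also have "\<dots> \<le> E * c\<^sup>2 * (2 * M) ^ (q - 2)"
      using M4 by (intro mult_left_mono power_mono) auto
    also have "\<dots> = E * c\<^sup>2 * 2 ^ (q - 2) * M ^ (q - 2)"
      by (simp add: power_mult_distrib)
    also have "\<dots> \<le> E * c\<^sup>2 * 2 ^ q * M ^ (q - 2)"
      by (intro mult_right_mono mult_left_mono power_increasing) simp_all
    also have "\<dots> = (2 ^ q * E * c) * c * M ^ (q - 2)"
      by (simp add: power2_eq_square)
    finally have "4 * m ^ q \<le> 4 * ((2 ^ q * E * c) * c * M ^ (q - 2)) ^ q"
      by (intro mult_left_mono power_mono) auto
    also have "\<dots> = M0 * c ^ q * (M ^ (q - 2)) ^ q"
      by (simp add: M0_def power_mult_distrib)
    also have "\<dots> \<le> M * k ^ q * (M ^ (q - 2)) ^ q"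
      using \<open>M0 \<le> M\<close> by (intro mult_mono power_mono) (auto simp: k_def)
    also have "\<dots> = k ^ q * B ^ (q - 1)"
    proof -
      have "Suc ((q - 2) * q) = (q - 1) * (q - 1)"
      proof -
        obtain n where "q = n + 3"
          using q by (metis add.commute le_Suc_ex)
        then show ?thesis by (simp add: algebra_simps)
      qed
      then have "M * (M ^ (q - 2)) ^ q = B ^ (q - 1)"
        by (simp only: B_def power_mult[symmetric] power_Suc[symmetric])
      then show ?thesis by simp
    qed
    finally have main: "4 * m ^ q \<le> k ^ q * B ^ (q - 1)" .
    have "4 * B * (m * k) ^ q = 4 * m ^ q * (B * k ^ q)"
      by (simp add: power_mult_distrib)
    also have "\<dots> \<le> k ^ q * B ^ (q - 1) * (B * k ^ q)"
      using main by (rule mult_right_mono) simp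
    also have "\<dots> = (k ^ q * k ^ q) * (B ^ (q - 1) * B)"
      by (simp only: mult_ac)
    also have "B ^ (q - 1) * B = B ^ q"
      using q by (simp add: power_eq_if)
    also have "k ^ q * k ^ q * B ^ q = (k\<^sup>2 * B) ^ q"
      by (simp add: power_mult_distrib power2_eq_square)
    finally show ?thesis .
  qed
  have shrink: "16 * real c * (1 - 1 / 2 ^ (q + 1)) ^ r \<le> 1"
  proof -
    have "16 * c \<le> E * Y"
    proof -
      have "2 ^ 4 * 1 * (c * 1) \<le> 2 ^ (13 * q + 8) * \<Lambda>\<^sup>2 * (c\<^sup>2 * M ^ (q - 2))"
        using \<Lambda>(1) M4 c by (intro mult_le_mono power_increasing) (auto simp: power2_eq_square)
      then show ?thesis by (simp add: E_def Y_def)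
    qed
    also have "\<dots> \<le> 2 ^ \<Lambda>"
      using Y(1) \<Lambda>(2) by linarith
    finally have "real (16 * c) \<le> real (2 ^ \<Lambda>)"
      by (rule of_nat_mono)
    moreover have "(1 - 1 / 2 ^ (q + 1)) ^ r \<le> 1 / (2 :: real) ^ \<Lambda>"
      using power_shrink_le[of "2 ^ (q + 1)" \<Lambda>] by (simp add: r_def)
    moreover have "0 \<le> (1 - 1 / 2 ^ (q + 1) :: real) ^ r"
      by (rule zero_le_power) (simp add: divide_le_eq_1 one_le_power mult_ge1_I)
    ultimately have "real (16 * c) * (1 - 1 / 2 ^ (q + 1)) ^ r \<le> real (2 ^ \<Lambda>) * (1 / 2 ^ \<Lambda>)"
      by (intro mult_mono) auto
    then show ?thesis by simp
  qed
  have "2 \<le> q" using q by simp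
  obtain P where "finite P" "card P \<le> m" "not_colorable q c P"
    using planar_set_not_colorable[OF \<open>2 \<le> q\<close> M4 c k_def B_def t_def shrink sample sparse] by blast
  then show ?thesis
    using \<open>2 \<le> q\<close> by (intro less_g_lines[of P])
qed

theorem proposition1p2:
  fixes \<eta> :: real and q m :: nat
  assumes "0 < \<eta>" and "3 \<le> q" and "\<eta> < (real q)\<^sup>2 - real q"
    and "real q \<le> 0.005 * \<eta> * (ln (real m) / ln (ln (real m))) powr (1 / 4)"
  shows "real (g_lines q m) \<ge> real m powr ((1 - \<eta>) / ((real q)\<^sup>2 - real q - \<eta>))"
proof -
  define D where "D = (real q)\<^sup>2 - real q"
  define \<rho> where "\<rho> = real m powr ((1 - \<eta>) / (D - \<eta>))"
  have "m \<noteq> 0"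
  proof
    assume "m = 0"
    then show False using assms(2,4) by simp
  qed
  then have m: "1 \<le> m" by simp
  have D: "\<eta> < D" "1 \<le> D"
  proof -
    show "\<eta> < D" using assms(3) by (simp add: D_def)
    have "1 * 1 \<le> real q * (real q - 1)"
      using assms(2) by (intro mult_mono) auto
    then show "1 \<le> D" by (simp add: D_def power2_eq_square algebra_simps)
  qed
  have "\<rho> \<le> g_lines q m"
  proof (cases "1 \<le> \<eta>")
    case True
    then have "\<rho> \<le> real m powr 0"
      unfolding \<rho>_def using m D by (intro powr_mono) (auto simp: divide_le_0_iff)
    also have "\<dots> \<le> g_lines q m"
      using g_lines_pos[of q m] assms(2) m by simp
    finally show ?thesis .
  next
    case False
    then have \<eta>: "\<eta> < 1" by simp
    note size = size_hypothesis[OF \<eta> assms(1,2,4)]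
    \<comment> \<open>The largest number of colors below \<open>\<rho>\<close>, or one color if there is none.\<close>
    define c where "c = max 1 (nat \<lceil>\<rho>\<rceil> - 1)"
    have c: "1 \<le> c" by (simp add: c_def)
    have "real c \<le> max 1 \<rho>"
      unfolding c_def by linarith
    also have "\<dots> \<le> real m powr (1 / D)"
    proof -
      have "\<eta> * 1 \<le> \<eta> * D"
        using D(2) assms(1) by (intro mult_left_mono) auto
      then have "(1 - \<eta>) / (D - \<eta>) \<le> 1 / D"
        using D assms(1) by (simp add: divide_simps algebra_simps)
      then have "\<rho> \<le> real m powr (1 / D)"
        unfolding \<rho>_def using m by (intro powr_mono) auto
      moreover have "1 \<le> real m powr (1 / D)"
        using m D by (intro ge_one_powr_ge_zero) auto
      ultimately show ?thesis by simp
    qed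
    finally have "ln (real c) \<le> ln (real m powr (1 / D))"
      using c m by (subst ln_le_cancel_iff) simp_all
    then have "ln (real c) * D \<le> ln (real m)"
      using D(2) m by (simp add: ln_powr field_simps)
    then have "c < g_lines q m"
      using parameters_fit[OF assms(2) size c] assms(2) c
      by (intro colors_less_g_lines) (auto simp: D_def)
    moreover have "\<rho> \<le> real c + 1"
      unfolding c_def by linarith
    ultimately show ?thesis by linarith
  qed
  then show ?thesis by (simp add: \<rho>_def D_def)
qed

end
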